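(* Let $L$ be a finite simple group, let $t\geq 1$ be an integer, and let $Q$ be the quandle $(L,t,1)$, where $1$ denotes the identity automorphism of $L$. Then $Q$ is primitive if and only if $t$ is prime.
   Context: A quandle is a set $Q$ with two binary operations $*,\backslash$ such that $x*(x\backslash y)=y=x\backslash(x*y)$, $x*x=x$ and $x*(y*z)=(x*y)*(x*z)$ for all $x,y,z$; each $L_x:y\mapsto x*y$ is a permutation, and $\mathrm{LMlt}(Q)=\langle L_x : x\in Q\rangle$. $Q$ is primitive if the action of $\mathrm{LMlt}(Q)$ on $Q$ is primitive, i.e. the action is transitive and the point stabilizers $\mathrm{LMlt}(Q)_x$ are maximal (in particular proper) subgroups of $\mathrm{LMlt}(Q)$. For a group $G$, $\theta\in\mathrm{Aut}(G)$ and a subgroup $H\leq \mathrm{Fix}(\theta)=\{x\in G:\theta(x)=x\}$, the coset quandle $\mathcal{Q}(G,H,\theta)$ is the set $G/H$ of left cosets with $xH*yH=x\theta(x^{-1}y)H$. For $t\geq 1$ let $\theta_t\in\mathrm{Aut}(G^t)$, $\theta_t(x_1,\ldots,x_t)=(\theta(x_t),x_1,\ldots,x_{t-1})$; its set of fixed points is $H_t=\{(x,\ldots,x):x\in \mathrm{Fix}(\theta)\}$. Then $(G,t,\theta)$ denotes the quandle $\mathcal{Q}(G^t,H_t,\theta_t)$.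
   Formalization: The finite simple group L is additionally assumed non-abelian; for abelian L the claim fails, e.g. L = Z_2, t = 2 gives a two-element quandle with trivial left translations, which is not primitive although t is prime. *)

theory Defs
  imports
    "HOL-Algebra.SimpleGroups"
    "HOL-Algebra.Left_Coset"
    "HOL-Algebra.Group_Action"
    "HOL-Algebra.Generated_Groups"
    "HOL-Algebra.Product_Groups"
begin

section \<open>Quandles\<close>

record 'a quandle = "'a partial_object" +
  qmult :: "'a \<Rightarrow> 'a \<Rightarrow> 'a" (infixl \<open>\<star>\<index>\<close> 70)
  qldiv :: "'a \<Rightarrow> 'a \<Rightarrow> 'a"

locale quandle =
  fixes Q :: "('a, 'b) quandle_scheme" (structure)
  assumes mult_closed: "\<lbrakk>x \<in> carrier Q; y \<in> carrier Q\<rbrakk> \<Longrightarrow> x \<star> y \<in> carrier Q"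
    and ldiv_closed: "\<lbrakk>x \<in> carrier Q; y \<in> carrier Q\<rbrakk> \<Longrightarrow> qldiv Q x y \<in> carrier Q"
    and mult_ldiv: "\<lbrakk>x \<in> carrier Q; y \<in> carrier Q\<rbrakk> \<Longrightarrow> x \<star> qldiv Q x y = y"
    and ldiv_mult: "\<lbrakk>x \<in> carrier Q; y \<in> carrier Q\<rbrakk> \<Longrightarrow> qldiv Q x (x \<star> y) = y"
    and idem: "x \<in> carrier Q \<Longrightarrow> x \<star> x = x"
    and left_distrib: "\<lbrakk>x \<in> carrier Q; y \<in> carrier Q; z \<in> carrier Q\<rbrakk>
          \<Longrightarrow> x \<star> (y \<star> z) = (x \<star> y) \<star> (x \<star> z)"

definition left_translation :: "('a, 'b) quandle_scheme \<Rightarrow> 'a \<Rightarrow> 'a \<Rightarrow> 'a" where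
  "left_translation Q x = (\<lambda>y\<in>carrier Q. x \<star>\<^bsub>Q\<^esub> y)"

lemma (in quandle) left_translation_Bij:
  assumes "x \<in> carrier Q"
  shows "left_translation Q x \<in> Bij (carrier Q)"
proof -
  have "bij_betw (left_translation Q x) (carrier Q) (carrier Q)"
    by (rule bij_betw_byWitness[where f' = "qldiv Q x"])
      (auto simp: left_translation_def assms mult_closed ldiv_closed mult_ldiv ldiv_mult)
  then show ?thesis
    by (simp add: Bij_def left_translation_def)
qed

definition LMlt :: "('a, 'b) quandle_scheme \<Rightarrow> ('a \<Rightarrow> 'a) monoid" where
  "LMlt Q = (BijGroup (carrier Q))
     \<lparr>carrier := generate (BijGroup (carrier Q)) (left_translation Q ` carrier Q)\<rparr>"

definition maximal_subgroup :: "'a set \<Rightarrow> ('a, 'b) monoid_scheme \<Rightarrow> bool" where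
  "maximal_subgroup M G \<longleftrightarrow> subgroup M G \<and> M \<noteq> carrier G \<and>
     (\<forall>K. subgroup K G \<and> M \<subseteq> K \<longrightarrow> K = M \<or> K = carrier G)"

definition primitive_quandle :: "('a, 'b) quandle_scheme \<Rightarrow> bool" where
  "primitive_quandle Q \<longleftrightarrow> quandle Q \<and>
     transitive_action (LMlt Q) (carrier Q) (\<lambda>f. f) \<and>
     (\<forall>x\<in>carrier Q. maximal_subgroup (stabilizer (LMlt Q) (\<lambda>f. f) x) (LMlt Q))"

section \<open>Coset quandles\<close>

definition Fix :: "('a, 'b) monoid_scheme \<Rightarrow> ('a \<Rightarrow> 'a) \<Rightarrow> 'a set" where
  "Fix G \<theta> = {x \<in> carrier G. \<theta> x = x}"

text \<open>The unions over all representatives collapse to a single coset when \<open>\<theta>\<close> is an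
  automorphism and \<open>H\<close> a subgroup of its fixed points; see \<open>coset_quandle_mult\<close> and
  \<open>coset_quandle_ldiv\<close>.\<close>

definition coset_quandle ::
    "('a, 'b) monoid_scheme \<Rightarrow> 'a set \<Rightarrow> ('a \<Rightarrow> 'a) \<Rightarrow> 'a set quandle" where
  "coset_quandle G H \<theta> =
     \<lparr>carrier = lcosets\<^bsub>G\<^esub> H,
      qmult = (\<lambda>A B. \<Union>x\<in>A. \<Union>y\<in>B. (x \<otimes>\<^bsub>G\<^esub> \<theta> (inv\<^bsub>G\<^esub> x \<otimes>\<^bsub>G\<^esub> y)) <#\<^bsub>G\<^esub> H),
      qldiv = (\<lambda>A B. \<Union>x\<in>A. \<Union>y\<in>B.
        (x \<otimes>\<^bsub>G\<^esub> inv_into (carrier G) \<theta> (inv\<^bsub>G\<^esub> x \<otimes>\<^bsub>G\<^esub> y)) <#\<^bsub>G\<^esub> H)\<rparr>"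

text \<open>Tuples in \<open>G\<^sup>t\<close> are indexed by \<open>0, \<dots>, t - 1\<close>.\<close>

definition power_group :: "('a, 'b) monoid_scheme \<Rightarrow> nat \<Rightarrow> (nat \<Rightarrow> 'a) monoid" where
  "power_group G t = product_group {..<t} (\<lambda>_. G)"

definition shift_auto ::
    "nat \<Rightarrow> ('a, 'b) monoid_scheme \<Rightarrow> ('a \<Rightarrow> 'a) \<Rightarrow> (nat \<Rightarrow> 'a) \<Rightarrow> nat \<Rightarrow> 'a" where
  "shift_auto t G \<theta> = (\<lambda>x\<in>carrier (power_group G t). \<lambda>i\<in>{..<t}.
     if i = 0 then \<theta> (x (t - 1)) else x (i - 1))"

definition diag_fix :: "nat \<Rightarrow> ('a, 'b) monoid_scheme \<Rightarrow> ('a \<Rightarrow> 'a) \<Rightarrow> (nat \<Rightarrow> 'a) set" where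
  "diag_fix t G \<theta> = (\<lambda>x. \<lambda>i\<in>{..<t}. x) ` Fix G \<theta>"

definition power_quandle ::
    "('a, 'b) monoid_scheme \<Rightarrow> nat \<Rightarrow> ('a \<Rightarrow> 'a) \<Rightarrow> (nat \<Rightarrow> 'a) set quandle" where
  "power_quandle G t \<theta> = coset_quandle (power_group G t) (diag_fix t G \<theta>) (shift_auto t G \<theta>)"

subsection \<open>Well-definedness\<close>

lemma auto_inv_into:
  assumes "group G" "\<theta> \<in> auto G"
  shows "restrict (inv_into (carrier G) \<theta>) (carrier G) \<in> auto G"
proof -
  interpret group G by fact
  have "inv\<^bsub>BijGroup (carrier G)\<^esub> \<theta> = restrict (inv_into (carrier G) \<theta>) (carrier G)"
    using assms by (intro inv_BijGroup) (auto simp: auto_def)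
  then show ?thesis
    using subgroup.m_inv_closed[OF subgroup_auto assms(2)] by simp
qed

lemma coset_op_eq:
  assumes "group G" "subgroup H G" "H \<subseteq> Fix G \<theta>" "\<theta> \<in> hom G G"
    and "x \<in> carrier G" "y \<in> carrier G"
  shows "(\<Union>x'\<in>x <#\<^bsub>G\<^esub> H. \<Union>y'\<in>y <#\<^bsub>G\<^esub> H. (x' \<otimes>\<^bsub>G\<^esub> \<theta> (inv\<^bsub>G\<^esub> x' \<otimes>\<^bsub>G\<^esub> y')) <#\<^bsub>G\<^esub> H)
         = (x \<otimes>\<^bsub>G\<^esub> \<theta> (inv\<^bsub>G\<^esub> x \<otimes>\<^bsub>G\<^esub> y)) <#\<^bsub>G\<^esub> H"
proof -
  interpret group G by fact
  interpret H: subgroup H G by fact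
  have cl: "\<theta> a \<in> carrier G" if "a \<in> carrier G" for a
    using assms(4) that by (auto simp: hom_def)
  have hm: "\<theta> (a \<otimes>\<^bsub>G\<^esub> b) = \<theta> a \<otimes>\<^bsub>G\<^esub> \<theta> b" if "a \<in> carrier G" "b \<in> carrier G" for a b
    using assms(4) that by (auto simp: hom_def)
  have fx: "\<theta> h = h" if "h \<in> H" for h
    using assms(3) that by (auto simp: Fix_def)
  have can: "a \<otimes>\<^bsub>G\<^esub> (inv\<^bsub>G\<^esub> a \<otimes>\<^bsub>G\<^esub> b) = b" if "a \<in> carrier G" "b \<in> carrier G" for a b
    using that by (simp flip: m_assoc)
  have *: "((x \<otimes>\<^bsub>G\<^esub> h) \<otimes>\<^bsub>G\<^esub> \<theta> (inv\<^bsub>G\<^esub> (x \<otimes>\<^bsub>G\<^esub> h) \<otimes>\<^bsub>G\<^esub> (y \<otimes>\<^bsub>G\<^esub> k))) <#\<^bsub>G\<^esub> H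
      = (x \<otimes>\<^bsub>G\<^esub> \<theta> (inv\<^bsub>G\<^esub> x \<otimes>\<^bsub>G\<^esub> y)) <#\<^bsub>G\<^esub> H" if "h \<in> H" "k \<in> H" for h k
  proof -
    have hk: "h \<in> carrier G" "k \<in> carrier G" using that H.mem_carrier by auto
    have "inv\<^bsub>G\<^esub> (x \<otimes>\<^bsub>G\<^esub> h) \<otimes>\<^bsub>G\<^esub> (y \<otimes>\<^bsub>G\<^esub> k) = inv\<^bsub>G\<^esub> h \<otimes>\<^bsub>G\<^esub> ((inv\<^bsub>G\<^esub> x \<otimes>\<^bsub>G\<^esub> y) \<otimes>\<^bsub>G\<^esub> k)"
      using assms hk by (simp add: inv_mult_group m_assoc)
    then have "\<theta> (inv\<^bsub>G\<^esub> (x \<otimes>\<^bsub>G\<^esub> h) \<otimes>\<^bsub>G\<^esub> (y \<otimes>\<^bsub>G\<^esub> k))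
        = inv\<^bsub>G\<^esub> h \<otimes>\<^bsub>G\<^esub> (\<theta> (inv\<^bsub>G\<^esub> x \<otimes>\<^bsub>G\<^esub> y) \<otimes>\<^bsub>G\<^esub> k)"
      using assms hk that by (simp add: hm fx)
    then have "(x \<otimes>\<^bsub>G\<^esub> h) \<otimes>\<^bsub>G\<^esub> \<theta> (inv\<^bsub>G\<^esub> (x \<otimes>\<^bsub>G\<^esub> h) \<otimes>\<^bsub>G\<^esub> (y \<otimes>\<^bsub>G\<^esub> k))
        = (x \<otimes>\<^bsub>G\<^esub> \<theta> (inv\<^bsub>G\<^esub> x \<otimes>\<^bsub>G\<^esub> y)) \<otimes>\<^bsub>G\<^esub> k"
      using assms hk by (simp add: m_assoc cl can)
    moreover have "k <#\<^bsub>G\<^esub> H = H"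
      using that by (simp add: coset_join3 hk(2) assms(2))
    ultimately show ?thesis
      using assms hk by (simp add: cl H.subset flip: lcos_m_assoc)
  qed
  let ?R = "(x \<otimes>\<^bsub>G\<^esub> \<theta> (inv\<^bsub>G\<^esub> x \<otimes>\<^bsub>G\<^esub> y)) <#\<^bsub>G\<^esub> H"
  have eq: "(x' \<otimes>\<^bsub>G\<^esub> \<theta> (inv\<^bsub>G\<^esub> x' \<otimes>\<^bsub>G\<^esub> y')) <#\<^bsub>G\<^esub> H = ?R"
    if xy': "x' \<in> x <#\<^bsub>G\<^esub> H" "y' \<in> y <#\<^bsub>G\<^esub> H" for x' y'
  proof -
    obtain h where "h \<in> H" "x' = x \<otimes>\<^bsub>G\<^esub> h"
      using xy'(1) by (auto simp: l_coset_def)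
    moreover obtain k where "k \<in> H" "y' = y \<otimes>\<^bsub>G\<^esub> k"
      using xy'(2) by (auto simp: l_coset_def)
    ultimately show ?thesis using *[of h k] by (simp only:)
  qed
  have "x <#\<^bsub>G\<^esub> H \<noteq> {}" "y <#\<^bsub>G\<^esub> H \<noteq> {}"
    using H.one_closed by (auto simp: l_coset_def simp del: H.one_closed)
  moreover have "(\<Union>x'\<in>x <#\<^bsub>G\<^esub> H. \<Union>y'\<in>y <#\<^bsub>G\<^esub> H. (x' \<otimes>\<^bsub>G\<^esub> \<theta> (inv\<^bsub>G\<^esub> x' \<otimes>\<^bsub>G\<^esub> y')) <#\<^bsub>G\<^esub> H)
      = (\<Union>x'\<in>x <#\<^bsub>G\<^esub> H. \<Union>y'\<in>y <#\<^bsub>G\<^esub> H. ?R)"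
    by (intro SUP_cong refl eq)
  ultimately show ?thesis by (simp only: UN_constant if_False)
qed

context
  fixes G :: "('a, 'b) monoid_scheme" (structure) and H \<theta>
  assumes G: "group G" and H: "subgroup H G" and HF: "H \<subseteq> Fix G \<theta>" and \<theta>: "\<theta> \<in> auto G"
begin

lemma coset_quandle_mult:
  assumes "x \<in> carrier G" "y \<in> carrier G"
  shows "(x <#\<^bsub>G\<^esub> H) \<star>\<^bsub>coset_quandle G H \<theta>\<^esub> (y <#\<^bsub>G\<^esub> H) = (x \<otimes> \<theta> (inv x \<otimes> y)) <#\<^bsub>G\<^esub> H"
  using coset_op_eq[OF G H HF _ assms] \<theta> by (simp add: coset_quandle_def auto_def)

lemma coset_quandle_ldiv:
  assumes "x \<in> carrier G" "y \<in> carrier G"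
  shows "qldiv (coset_quandle G H \<theta>) (x <#\<^bsub>G\<^esub> H) (y <#\<^bsub>G\<^esub> H)
    = (x \<otimes> inv_into (carrier G) \<theta> (inv x \<otimes> y)) <#\<^bsub>G\<^esub> H"
proof -
  interpret group G by (rule G)
  interpret H: subgroup H G by (rule H)
  let ?\<psi> = "restrict (inv_into (carrier G) \<theta>) (carrier G)"
  have inj: "inj_on \<theta> (carrier G)"
    using \<theta> by (auto simp: auto_def Bij_def bij_betw_def)
  have "H \<subseteq> Fix G ?\<psi>"
    using HF inj by (fastforce simp: Fix_def intro: inv_into_f_eq)
  moreover have "?\<psi> \<in> hom G G"
    using auto_inv_into[OF G \<theta>] by (simp add: auto_def)
  ultimately have "(\<Union>x'\<in>x <#\<^bsub>G\<^esub> H. \<Union>y'\<in>y <#\<^bsub>G\<^esub> H. (x' \<otimes> ?\<psi> (inv x' \<otimes> y')) <#\<^bsub>G\<^esub> H)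
         = (x \<otimes> ?\<psi> (inv x \<otimes> y)) <#\<^bsub>G\<^esub> H"
    using coset_op_eq[OF G H _ _ assms] by blast
  moreover have "x' \<in> carrier G" if "x' \<in> z <#\<^bsub>G\<^esub> H" "z \<in> carrier G" for x' z
    using that H.elemlcos_carrier[OF G] by blast
  ultimately show ?thesis
    using assms by (simp add: coset_quandle_def)
qed

lemma quandle_coset_quandle: "quandle (coset_quandle G H \<theta>)"
proof -
  interpret group G by (rule G)
  interpret H: subgroup H G by (rule H)
  let ?Q = "coset_quandle G H \<theta>"
  let ?\<psi> = "inv_into (carrier G) \<theta>"
  have bij: "bij_betw \<theta> (carrier G) (carrier G)" and hom: "\<theta> \<in> hom G G"
    using \<theta> by (auto simp: auto_def Bij_def)
  have cl [simp]: "\<theta> a \<in> carrier G" "?\<psi> a \<in> carrier G" if "a \<in> carrier G" for a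
    using bij that by (auto simp: bij_betw_def intro: inv_into_into)
  have hm: "\<theta> (a \<otimes> b) = \<theta> a \<otimes> \<theta> b" if "a \<in> carrier G" "b \<in> carrier G" for a b
    using hom that by (auto simp: hom_def)
  have hi: "\<theta> (inv a) = inv (\<theta> a)" if "a \<in> carrier G" for a
    using hom that by (meson group_hom.hom_inv group_hom.intro group_hom_axioms.intro G)
  have h1: "\<theta> \<one> = \<one>"
    using hom by (meson hom_one G)
  have inv1: "\<theta> (?\<psi> a) = a" "?\<psi> (\<theta> a) = a" if "a \<in> carrier G" for a
    using bij that by (auto simp: bij_betw_inv_into_left bij_betw_inv_into_right)
  have can: "inv a \<otimes> (a \<otimes> b) = b" "a \<otimes> (inv a \<otimes> b) = b"
    if "a \<in> carrier G" "b \<in> carrier G" for a b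
    using that by (simp_all flip: m_assoc)
  have carr: "carrier ?Q = (\<lambda>x. x <#\<^bsub>G\<^esub> H) ` carrier G"
    by (auto simp: coset_quandle_def LCOSETS_def)
  note ops = coset_quandle_mult coset_quandle_ldiv
  show ?thesis
  proof
    fix A B C assume *: "A \<in> carrier ?Q" "B \<in> carrier ?Q" "C \<in> carrier ?Q"
    then obtain x y z where xyz [simp]: "x \<in> carrier G" "y \<in> carrier G" "z \<in> carrier G"
      and ABC: "A = x <#\<^bsub>G\<^esub> H" "B = y <#\<^bsub>G\<^esub> H" "C = z <#\<^bsub>G\<^esub> H"
      unfolding carr by auto
    show "A \<star>\<^bsub>?Q\<^esub> (B \<star>\<^bsub>?Q\<^esub> C) = (A \<star>\<^bsub>?Q\<^esub> B) \<star>\<^bsub>?Q\<^esub> (A \<star>\<^bsub>?Q\<^esub> C)"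
      by (simp add: ABC ops hm hi inv_mult_group m_assoc can)
  next
    fix A B assume *: "A \<in> carrier ?Q" "B \<in> carrier ?Q"
    then obtain x y where xy [simp]: "x \<in> carrier G" "y \<in> carrier G"
      and AB: "A = x <#\<^bsub>G\<^esub> H" "B = y <#\<^bsub>G\<^esub> H"
      unfolding carr by auto
    show "A \<star>\<^bsub>?Q\<^esub> B \<in> carrier ?Q" "qldiv ?Q A B \<in> carrier ?Q"
      by (auto simp: AB ops carr)
    show "A \<star>\<^bsub>?Q\<^esub> qldiv ?Q A B = B" "qldiv ?Q A (A \<star>\<^bsub>?Q\<^esub> B) = B"
      by (simp_all add: AB ops can inv1)
  next
    fix A assume "A \<in> carrier ?Q"
    then obtain x where "x \<in> carrier G" "A = x <#\<^bsub>G\<^esub> H"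
      unfolding carr by auto
    then show "A \<star>\<^bsub>?Q\<^esub> A = A"
      by (simp add: ops h1)
  qed
qed

end

lemma group_power_group: "group G \<Longrightarrow> group (power_group G t)"
  by (simp add: power_group_def)

lemma shift_auto_in_auto:
  assumes "group G" "\<theta> \<in> auto G"
  shows "shift_auto t G \<theta> \<in> auto (power_group G t)"
proof -
  have bij: "bij_betw \<theta> (carrier G) (carrier G)" and hom: "\<theta> \<in> hom G G"
    using assms by (auto simp: auto_def Bij_def)
  let ?P = "carrier (power_group G t)"
  let ?g = "\<lambda>x. \<lambda>i\<in>{..<t}. if i = t - 1 then inv_into (carrier G) \<theta> (x 0) else x (i + 1)"
  have P: "?P = {..<t} \<rightarrow>\<^sub>E carrier G" by (simp add: power_group_def)
  have cl: "\<theta> a \<in> carrier G" "inv_into (carrier G) \<theta> a \<in> carrier G" if "a \<in> carrier G" for a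
    using bij that by (auto simp: bij_betw_def intro: inv_into_into)
  have inv1: "\<theta> (inv_into (carrier G) \<theta> a) = a" "inv_into (carrier G) \<theta> (\<theta> a) = a"
    if "a \<in> carrier G" for a
    using bij that by (auto simp: bij_betw_inv_into_left bij_betw_inv_into_right)
  have sh: "shift_auto t G \<theta> x \<in> ?P" if "x \<in> ?P" for x
    using that by (auto simp: shift_auto_def P PiE_iff cl)
  have g: "?g x \<in> ?P" if "x \<in> ?P" for x
    using that by (auto simp: P PiE_iff cl)
  have "bij_betw (shift_auto t G \<theta>) ?P ?P"
  proof (rule bij_betw_byWitness[where f' = ?g])
    show "\<forall>x\<in>?P. ?g (shift_auto t G \<theta> x) = x"
    proof
      fix x assume x: "x \<in> ?P"
      show "?g (shift_auto t G \<theta> x) = x"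
      proof
        fix i show "?g (shift_auto t G \<theta> x) i = x i"
          using x sh[OF x] PiE_arb[OF x[unfolded P], of i]
          by (cases "i < t") (auto simp: shift_auto_def P PiE_iff inv1)
      qed
    qed
    show "\<forall>x\<in>?P. shift_auto t G \<theta> (?g x) = x"
    proof
      fix x assume x: "x \<in> ?P"
      show "shift_auto t G \<theta> (?g x) = x"
      proof
        fix i show "shift_auto t G \<theta> (?g x) i = x i"
          using x g[OF x] PiE_arb[OF x[unfolded P], of i]
          by (cases "i < t") (auto simp: shift_auto_def P PiE_iff inv1)
      qed
    qed
  qed (use sh g in auto)
  moreover have "shift_auto t G \<theta> \<in> hom (power_group G t) (power_group G t)"
  proof (rule homI)
    fix x y assume x: "x \<in> ?P" and y: "y \<in> ?P"
    have xy: "x \<otimes>\<^bsub>power_group G t\<^esub> y \<in> ?P"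
      using x y by (meson assms(1) group.is_monoid group_power_group monoid.m_closed)
    show "shift_auto t G \<theta> (x \<otimes>\<^bsub>power_group G t\<^esub> y)
      = shift_auto t G \<theta> x \<otimes>\<^bsub>power_group G t\<^esub> shift_auto t G \<theta> y"
    proof
      fix i
      have "x (t - 1) \<in> carrier G" "y (t - 1) \<in> carrier G" if "i < t"
        using x y that by (auto simp: P PiE_iff)
      with x y xy hom show "shift_auto t G \<theta> (x \<otimes>\<^bsub>power_group G t\<^esub> y) i
          = (shift_auto t G \<theta> x \<otimes>\<^bsub>power_group G t\<^esub> shift_auto t G \<theta> y) i"
        by (cases "i < t") (auto simp: shift_auto_def hom_def power_group_def product_group_def)
    qed
  qed (rule sh)
  ultimately show ?thesis
    by (simp add: auto_def Bij_def shift_auto_def)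
qed

lemma Fix_shift_auto:
  assumes "t \<ge> 1"
  shows "Fix (power_group G t) (shift_auto t G \<theta>) = diag_fix t G \<theta>"
proof (intro Set.set_eqI iffI)
  fix x assume "x \<in> Fix (power_group G t) (shift_auto t G \<theta>)"
  then have x: "x \<in> {..<t} \<rightarrow>\<^sub>E carrier G" and fx: "shift_auto t G \<theta> x = x"
    by (auto simp: Fix_def power_group_def)
  have eq: "x i = (if i = 0 then \<theta> (x (t - 1)) else x (i - 1))" if "i < t" for i
    using fun_cong[OF fx, of i] x that by (simp add: shift_auto_def power_group_def)
  have const: "i < t \<Longrightarrow> x i = x 0" for i
  proof (induction i)
    case (Suc i)
    then show ?case using eq[of "Suc i"] by simp
  qed simp
  have "\<theta> (x 0) = x 0"
    using eq[of 0] const[of "t - 1"] assms by simp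
  moreover have "x 0 \<in> carrier G" using x assms by (auto simp: PiE_iff)
  moreover have "x = (\<lambda>i\<in>{..<t}. x 0)"
  proof
    fix i show "x i = (\<lambda>i\<in>{..<t}. x 0) i"
      using const[of i] PiE_arb[OF x, of i] by (cases "i < t") simp_all
  qed
  ultimately show "x \<in> diag_fix t G \<theta>"
    unfolding diag_fix_def Fix_def by (intro image_eqI CollectI conjI)
next
  fix x assume "x \<in> diag_fix t G \<theta>"
  then obtain a where a: "a \<in> carrier G" "\<theta> a = a" and x: "x = (\<lambda>i\<in>{..<t}. a)"
    unfolding diag_fix_def Fix_def by auto
  have carr: "x \<in> carrier (power_group G t)"
    using a by (simp add: x power_group_def)
  moreover have "shift_auto t G \<theta> x = x"
  proof
    fix i show "shift_auto t G \<theta> x i = x i"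
      using carr a by (cases "i < t") (auto simp: shift_auto_def x)
  qed
  ultimately show "x \<in> Fix (power_group G t) (shift_auto t G \<theta>)"
    by (simp add: Fix_def)
qed

lemma subgroup_Fix:
  assumes "group G" "\<theta> \<in> auto G"
  shows "subgroup (Fix G \<theta>) G"
proof -
  interpret group G by fact
  interpret group_hom G G \<theta>
    using assms by (auto simp: auto_def intro!: group_hom.intro group_hom_axioms.intro)
  show ?thesis
    by (rule subgroupI) (auto simp: Fix_def intro!: exI[of _ "\<one>\<^bsub>G\<^esub>"])
qed

lemma quandle_power_quandle:
  assumes "group G" "\<theta> \<in> auto G" "t \<ge> 1"
  shows "quandle (power_quandle G t \<theta>)"
  unfolding power_quandle_def Fix_shift_auto[OF assms(3), symmetric]
  using assms by (intro quandle_coset_quandle subgroup_Fix group_power_group shift_auto_in_auto) auto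

end

theory Submission
  imports Defs "HOL-Number_Theory.Cong"
begin

text \<open>
  Write \<open>G\<close> for \<open>L\<^sup>t\<close>, \<open>H\<close> for its diagonal and \<open>\<sigma>\<close> for the cyclic shift, so that the quandle lives on
  the cosets \<open>G/H\<close>. The left translation by \<open>xH\<close> applies \<open>\<sigma>\<close> and then multiplies by \<open>x \<sigma>(x)\<^sup>-\<^sup>1\<close>. If these
  quotients generate \<open>G\<close>, the left multiplication group contains the whole action of \<open>G\<close>, hence is
  transitive, and its subgroups above a point stabilizer correspond to the \<open>\<sigma>\<close>-stable subgroups
  between \<open>H\<close> and \<open>G\<close>. Primitivity then says that \<open>H\<close> is a maximal proper \<open>\<sigma>\<close>-stable subgroup
  (\<open>primitive_coset_quandleI\<close>). Conversely, for every coset quandle an intermediate \<open>\<sigma>\<close>-stable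
  subgroup \<open>K\<close> partitions the points into the cosets of \<open>K\<close>, and this congruence contradicts
  primitivity (\<open>primitive_coset_quandleD\<close>).

  A nonabelian simple group is perfect, and this forces the quotients \<open>x \<sigma>(x)\<^sup>-\<^sup>1\<close> to generate \<open>L\<^sup>t\<close>
  once \<open>t \<ge> 2\<close> (\<open>generate_shift_quotients\<close>). A \<open>\<sigma>\<close>-stable subgroup \<open>K\<close> above the diagonal is then
  studied through the pairs of coordinates that agree on all of \<open>K\<close>. If no two coordinates agree,
  simplicity gives \<open>K = L\<^sup>t\<close> (\<open>separating_subgroup_eq_carrier\<close>). If two agree, \<open>\<sigma>\<close>-stability spreads
  the coincidence around the cycle of length \<open>t\<close>, and when \<open>t\<close> is prime all coordinates agree, so
  that \<open>K\<close> is the diagonal (\<open>prime_shift_stable_subgroup\<close>). If \<open>t\<close> has a divisor \<open>r\<close> with \<open>1 < r < t\<close>,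
  the tuples of period \<open>r\<close> form a strictly intermediate \<open>\<sigma>\<close>-stable subgroup; and for \<open>t = 1\<close> the
  quandle is a single point, whose stabilizer is not proper.
\<close>

section \<open>Primitive quandles\<close>

lemma LMlt_subgroup:
  assumes "quandle Q"
  shows "subgroup (carrier (LMlt Q)) (BijGroup (carrier Q))"
proof -
  interpret B: group "BijGroup (carrier Q)" by (rule group_BijGroup)
  have "left_translation Q ` carrier Q \<subseteq> carrier (BijGroup (carrier Q))"
    using quandle.left_translation_Bij[OF assms] by (auto simp: BijGroup_def)
  then show ?thesis
    by (simp add: LMlt_def B.generate_is_subgroup)
qed

lemma BijGroup_mult_apply:
  assumes "f \<in> Bij S" "g \<in> Bij S" "x \<in> S"
  shows "(f \<otimes>\<^bsub>BijGroup S\<^esub> g) x = f (g x)"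
  using assms by (simp add: BijGroup_def compose_def)

lemma BijGroup_inv_apply:
  assumes "f \<in> Bij S" "x \<in> S"
  shows "f ((inv\<^bsub>BijGroup S\<^esub> f) x) = x"
  using assms by (auto simp: inv_BijGroup Bij_def bij_betw_inv_into_right)

lemma Bij_apply_closed: "f \<in> Bij S \<Longrightarrow> x \<in> S \<Longrightarrow> f x \<in> S"
  using Bij_imp_funcset by fastforce

lemma LMlt_mult: "monoid.mult (LMlt Q) = monoid.mult (BijGroup (carrier Q))"
  by (simp add: LMlt_def)

lemma LMlt_subgroup_iff:
  assumes "quandle Q"
  shows "subgroup K (LMlt Q) \<longleftrightarrow> subgroup K (BijGroup (carrier Q)) \<and> K \<subseteq> carrier (LMlt Q)"
proof -
  have M: "LMlt Q = (BijGroup (carrier Q))\<lparr>carrier := carrier (LMlt Q)\<rparr>"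
    by (simp add: LMlt_def)
  show ?thesis
    using group.incl_subgroup[OF group_BijGroup LMlt_subgroup[OF assms], of K]
      group.subgroup_incl[OF group_BijGroup _ LMlt_subgroup[OF assms], of K] subgroup.subset[of K "LMlt Q"]
    by (metis M)
qed

lemma maximal_subgroup_LMlt_iff:
  assumes "quandle Q"
  shows "maximal_subgroup N (LMlt Q) \<longleftrightarrow>
    subgroup N (BijGroup (carrier Q)) \<and> N \<subset> carrier (LMlt Q) \<and>
    (\<forall>K. subgroup K (BijGroup (carrier Q)) \<and> N \<subseteq> K \<and> K \<subseteq> carrier (LMlt Q)
      \<longrightarrow> K = N \<or> K = carrier (LMlt Q))"
  unfolding maximal_subgroup_def LMlt_subgroup_iff[OF assms] by blast

lemma stabilizer_LMlt_subgroup: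
  assumes "quandle Q" "x \<in> carrier Q"
  shows "subgroup (stabilizer (LMlt Q) (\<lambda>f. f) x) (BijGroup (carrier Q))"
proof -
  interpret B: group "BijGroup (carrier Q)" by (rule group_BijGroup)
  interpret S: subgroup "carrier (LMlt Q)" "BijGroup (carrier Q)"
    by (rule LMlt_subgroup[OF assms(1)])
  have Bij: "f \<in> Bij (carrier Q)" if "f \<in> carrier (LMlt Q)" for f
    using S.subset that by (auto simp: BijGroup_def)
  show ?thesis
  proof (rule B.subgroupI)
    show "stabilizer (LMlt Q) (\<lambda>f. f) x \<subseteq> carrier (BijGroup (carrier Q))"
      using S.subset by (auto simp: stabilizer_def)
    have "(\<lambda>x\<in>carrier Q. x) \<in> stabilizer (LMlt Q) (\<lambda>f. f) x"
      using S.one_closed assms(2) by (simp add: stabilizer_def BijGroup_def)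
    then show "stabilizer (LMlt Q) (\<lambda>f. f) x \<noteq> {}" by blast
  next
    fix f assume "f \<in> stabilizer (LMlt Q) (\<lambda>f. f) x"
    then show "inv\<^bsub>BijGroup (carrier Q)\<^esub> f \<in> stabilizer (LMlt Q) (\<lambda>f. f) x"
      using Bij[of f] assms(2) unfolding stabilizer_def
      using S.m_inv_closed[of f] by (simp add: inv_BijGroup Bij_def bij_betw_def inv_into_f_eq)
  next
    fix f g assume "f \<in> stabilizer (LMlt Q) (\<lambda>f. f) x" "g \<in> stabilizer (LMlt Q) (\<lambda>f. f) x"
    then show "f \<otimes>\<^bsub>BijGroup (carrier Q)\<^esub> g \<in> stabilizer (LMlt Q) (\<lambda>f. f) x"
      using Bij assms(2) by (auto simp: stabilizer_def BijGroup_mult_apply)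
  qed
qed

text \<open>Invariance is an equivalence, not just an implication, because the group generated by the left
  translations also contains their inverses.\<close>

lemma LMlt_preserves_congruence:
  assumes "quandle Q"
    and R: "\<And>x y z. \<lbrakk>x \<in> carrier Q; y \<in> carrier Q; z \<in> carrier Q\<rbrakk>
      \<Longrightarrow> (x \<star>\<^bsub>Q\<^esub> y, x \<star>\<^bsub>Q\<^esub> z) \<in> R \<longleftrightarrow> (y, z) \<in> R"
    and "f \<in> carrier (LMlt Q)" "y \<in> carrier Q" "z \<in> carrier Q"
  shows "(f y, f z) \<in> R \<longleftrightarrow> (y, z) \<in> R"
proof -
  interpret quandle Q by fact
  interpret B: group "BijGroup (carrier Q)" by (rule group_BijGroup)
  let ?inv = "\<lambda>f. inv\<^bsub>BijGroup (carrier Q)\<^esub> f"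
  have Bij: "g \<in> Bij (carrier Q)" if "g \<in> carrier (LMlt Q)" for g
    using subgroup.subset[OF LMlt_subgroup[OF assms(1)]] that by (auto simp: BijGroup_def)
  have "f \<in> generate (BijGroup (carrier Q)) (left_translation Q ` carrier Q)"
    using assms(3) by (simp add: LMlt_def)
  then show ?thesis using assms(4,5)
  proof (induction arbitrary: y z)
    case one
    then show ?case by (simp add: BijGroup_def)
  next
    case (incl h)
    then show ?case by (auto simp: left_translation_def R)
  next
    case (inv h)
    then obtain x where x: "x \<in> carrier Q" and h: "h = left_translation Q x" by blast
    have hB: "h \<in> Bij (carrier Q)" unfolding h by (rule left_translation_Bij[OF x])
    then have "?inv h \<in> Bij (carrier Q)"
      using B.inv_closed[of h] by (simp add: BijGroup_def)
    then have cl: "?inv h y \<in> carrier Q" "?inv h z \<in> carrier Q"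
      using inv.prems by (simp_all add: Bij_apply_closed)
    have "(h (?inv h y), h (?inv h z)) \<in> R \<longleftrightarrow> (?inv h y, ?inv h z) \<in> R"
      using cl x by (simp add: h left_translation_def R)
    then show ?case using hB inv.prems by (simp add: BijGroup_inv_apply)
  next
    case (eng g h)
    then have "g \<in> Bij (carrier Q)" "h \<in> Bij (carrier Q)"
      using Bij by (auto simp: LMlt_def)
    with eng show ?case by (simp add: BijGroup_mult_apply Bij_apply_closed)
  qed
qed

text \<open>Fix a point \<open>a\<close>. The permutations that keep \<open>a\<close> within its class form a subgroup above the
  stabilizer of \<open>a\<close>. Maximality leaves two possibilities, and by transitivity they say that the
  class of \<open>a\<close> is a singleton or everything.\<close>

lemma primitive_quandle_congruence:
  assumes "primitive_quandle Q" and eq: "equiv (carrier Q) R"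
    and R: "\<And>x y z. \<lbrakk>x \<in> carrier Q; y \<in> carrier Q; z \<in> carrier Q\<rbrakk>
      \<Longrightarrow> (x \<star>\<^bsub>Q\<^esub> y, x \<star>\<^bsub>Q\<^esub> z) \<in> R \<longleftrightarrow> (y, z) \<in> R"
  shows "R = Id_on (carrier Q) \<or> R = carrier Q \<times> carrier Q"
proof (cases "R \<subseteq> Id_on (carrier Q)")
  case True
  then show ?thesis using eq by (auto simp: equiv_def refl_on_def)
next
  case False
  have Q: "quandle Q" and tr: "transitive_action (LMlt Q) (carrier Q) (\<lambda>f. f)"
    and mx: "\<And>x. x \<in> carrier Q \<Longrightarrow> maximal_subgroup (stabilizer (LMlt Q) (\<lambda>f. f) x) (LMlt Q)"
    using assms(1) by (auto simp: primitive_quandle_def)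
  interpret B: group "BijGroup (carrier Q)" by (rule group_BijGroup)
  interpret S: subgroup "carrier (LMlt Q)" "BijGroup (carrier Q)"
    by (rule LMlt_subgroup[OF Q])
  have Bij: "f \<in> Bij (carrier Q)" if "f \<in> carrier (LMlt Q)" for f
    using S.subset that by (auto simp: BijGroup_def)
  have pres: "(f y, f z) \<in> R \<longleftrightarrow> (y, z) \<in> R"
    if "f \<in> carrier (LMlt Q)" "y \<in> carrier Q" "z \<in> carrier Q" for f y z
    using LMlt_preserves_congruence[OF Q R that] .
  have Rc: "R \<subseteq> carrier Q \<times> carrier Q" and rf: "\<And>x. x \<in> carrier Q \<Longrightarrow> (x, x) \<in> R"
    and sy: "\<And>x y. (x, y) \<in> R \<Longrightarrow> (y, x) \<in> R"
    and trn: "\<And>x y z. (x, y) \<in> R \<Longrightarrow> (y, z) \<in> R \<Longrightarrow> (x, z) \<in> R"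
    using eq by (auto simp: equiv_def refl_on_def dest: symD transD)
  from False Rc obtain a b where ab: "(a, b) \<in> R" "a \<noteq> b" "a \<in> carrier Q" "b \<in> carrier Q"
    by blast
  let ?N = "{f \<in> carrier (LMlt Q). (f a, a) \<in> R}"
  let ?St = "stabilizer (LMlt Q) (\<lambda>f. f) a"
  have "subgroup ?N (BijGroup (carrier Q))"
  proof (rule B.subgroupI)
    show "?N \<subseteq> carrier (BijGroup (carrier Q))" using S.subset by blast
    have "(\<lambda>x\<in>carrier Q. x) \<in> ?N"
      using S.one_closed ab rf by (simp add: BijGroup_def)
    then show "?N \<noteq> {}" by blast
  next
    fix f assume f: "f \<in> ?N"
    let ?g = "inv\<^bsub>BijGroup (carrier Q)\<^esub> f"
    have g: "?g \<in> carrier (LMlt Q)" using f by simp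
    then have ga: "?g a \<in> carrier Q" using Bij ab by (simp add: Bij_apply_closed)
    have "f (?g a) = a" using f Bij ab by (simp add: BijGroup_inv_apply)
    then have "(f a, f (?g a)) \<in> R" using f by simp
    then have "(a, ?g a) \<in> R" using pres[of f a "?g a"] f ga ab by simp
    then show "?g \<in> ?N" using g sy by blast
  next
    fix f g assume fg: "f \<in> ?N" "g \<in> ?N"
    then have "(f (g a), f a) \<in> R"
      using pres[of f "g a" a] Bij ab by (simp add: Bij_apply_closed)
    with fg have "(f (g a), a) \<in> R" using trn by blast
    then show "f \<otimes>\<^bsub>BijGroup (carrier Q)\<^esub> g \<in> ?N"
      using fg Bij ab by (simp add: BijGroup_mult_apply)
  qed
  moreover have "?St \<subseteq> ?N" using rf ab by (auto simp: stabilizer_def)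
  ultimately have "?N = ?St \<or> ?N = carrier (LMlt Q)"
    using mx[OF ab(3)] unfolding maximal_subgroup_LMlt_iff[OF Q] by blast
  moreover have "?N \<noteq> ?St"
  proof
    obtain f where f: "f \<in> carrier (LMlt Q)" "f a = b"
      using transitive_action.unique_orbit[OF tr ab(3,4)] by blast
    assume "?N = ?St"
    then have "f \<in> ?St" using f sy[OF ab(1)] by blast
    then show False using f ab(2) by (simp add: stabilizer_def)
  qed
  ultimately have all: "?N = carrier (LMlt Q)" by blast
  have "(x, a) \<in> R" if x: "x \<in> carrier Q" for x
  proof -
    obtain f where "f \<in> carrier (LMlt Q)" "f a = x"
      using transitive_action.unique_orbit[OF tr ab(3) x] by blast
    with all show ?thesis by blast
  qed
  then have "carrier Q \<times> carrier Q \<subseteq> R" using sy trn by blast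
  with Rc show ?thesis by blast
qed

lemma primitive_quandle_not_singleton:
  assumes "primitive_quandle Q"
  shows "carrier Q \<noteq> {x}"
proof
  assume Qx: "carrier Q = {x}"
  have Q: "quandle Q" using assms by (simp add: primitive_quandle_def)
  have "f x = x" if "f \<in> carrier (LMlt Q)" for f
    using subgroup.subset[OF LMlt_subgroup[OF Q]] that Bij_apply_closed[of f "carrier Q" x]
    by (auto simp: BijGroup_def Qx)
  then have "stabilizer (LMlt Q) (\<lambda>f. f) x = carrier (LMlt Q)"
    by (auto simp: stabilizer_def)
  then show False
    using assms Qx by (auto simp: primitive_quandle_def maximal_subgroup_def)
qed

section \<open>Primitive coset quandles\<close>

locale coset_quandle_data = group G for G (structure) +
  fixes H \<theta>
  assumes H: "subgroup H G" and H_Fix: "H \<subseteq> Fix G \<theta>" and \<theta>: "\<theta> \<in> auto G"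
begin

abbreviation Q where "Q \<equiv> coset_quandle G H \<theta>"

abbreviation B where "B \<equiv> BijGroup (carrier Q)"

text \<open>Members of the group of bijections are undefined outside their domain; hence the restriction
  to the cosets.\<close>

definition act :: "'a \<Rightarrow> 'a set \<Rightarrow> 'a set" where
  "act g = (\<lambda>C\<in>carrier Q. g <# C)"

sublocale quandle Q
  by (rule quandle_coset_quandle[OF is_group H H_Fix \<theta>])

sublocale H: subgroup H G by (rule H)

sublocale B: group B by (rule group_BijGroup)

sublocale theta: group_hom G G \<theta>
  using \<theta> by (auto simp: auto_def intro!: group_hom.intro group_hom_axioms.intro)

lemma cancel [simp]:
  "\<lbrakk>a \<in> carrier G; b \<in> carrier G\<rbrakk> \<Longrightarrow> inv a \<otimes> (a \<otimes> b) = b"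
  "\<lbrakk>a \<in> carrier G; b \<in> carrier G\<rbrakk> \<Longrightarrow> a \<otimes> (inv a \<otimes> b) = b"
  by (simp_all flip: m_assoc)

lemma carrier_Q: "carrier Q = (\<lambda>x. x <# H) ` carrier G"
  by (auto simp: coset_quandle_def LCOSETS_def)

lemma coset_in_Q [simp]: "x \<in> carrier G \<Longrightarrow> x <# H \<in> carrier Q"
  by (simp add: carrier_Q)

lemma coset_eq_iff:
  assumes "x \<in> carrier G" "y \<in> carrier G"
  shows "x <# H = y <# H \<longleftrightarrow> inv x \<otimes> y \<in> H"
  by (metis H.lcos_module_imp H.lcos_module_rev assms is_group lcos_self H l_repr_independence)

lemma left_translation_coset:
  assumes "x \<in> carrier G" "y \<in> carrier G"
  shows "left_translation Q (x <# H) (y <# H) = (x \<otimes> \<theta> (inv x \<otimes> y)) <# H"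
  using assms by (simp add: left_translation_def coset_quandle_mult[OF is_group H H_Fix \<theta>])

lemma act_coset:
  assumes "g \<in> carrier G" "y \<in> carrier G"
  shows "act g (y <# H) = (g \<otimes> y) <# H"
  using assms by (simp add: act_def lcos_m_assoc H.subset)

lemma act_Bij: "g \<in> carrier G \<Longrightarrow> act g \<in> Bij (carrier Q)"
proof -
  assume g: "g \<in> carrier G"
  have "bij_betw (act g) (carrier Q) (carrier Q)"
    by (rule bij_betw_byWitness[where f' = "act (inv g)"])
      (auto simp: carrier_Q act_coset g)
  then show ?thesis by (simp add: Bij_def act_def)
qed

lemma left_translation_in_Bij: "x \<in> carrier G \<Longrightarrow> left_translation Q (x <# H) \<in> Bij (carrier Q)"
  by (simp add: left_translation_Bij)

lemma Bij_eqI: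
  assumes "f \<in> Bij (carrier Q)" "f' \<in> Bij (carrier Q)"
    and "\<And>y. y \<in> carrier G \<Longrightarrow> f (y <# H) = f' (y <# H)"
  shows "f = f'"
  using assms by (intro extensionalityI[of f "carrier Q"]) (auto simp: Bij_def carrier_Q)

lemma carrier_B: "carrier B = Bij (carrier Q)"
  by (simp add: BijGroup_def)

lemmas Bij_mult_closed = B.m_closed[unfolded carrier_B]

lemma act_hom: "group_hom G B act"
proof (intro group_hom.intro group_hom_axioms.intro homI)
  show "act g \<in> carrier B" if "g \<in> carrier G" for g
    using that by (simp add: carrier_B act_Bij)
  show "act (g \<otimes> h) = act g \<otimes>\<^bsub>B\<^esub> act h" if "g \<in> carrier G" "h \<in> carrier G" for g h
    using that
    by (intro Bij_eqI Bij_mult_closed) (auto simp: act_Bij BijGroup_mult_apply act_coset m_assoc)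
qed (rule is_group group_BijGroup)+

sublocale act: group_hom G B act by (rule act_hom)

declare act.hom_mult [simp del] act.hom_inv [simp del]

text \<open>The next three identities transfer the relations of the semidirect product of \<open>G\<close> with the
  cyclic group generated by \<open>\<theta>\<close> to permutations of the cosets, without constructing that product: \<open>G\<close>
  permutes the left translations, the left translation by \<open>xH\<close> acts on \<open>G\<close> as \<open>\<theta>\<close> conjugated by \<open>x\<close>,
  and every left translation differs from the one by \<open>H\<close> by an element of \<open>G\<close>.\<close>

lemma act_left_translation:
  assumes "g \<in> carrier G" "x \<in> carrier G"
  shows "act g \<otimes>\<^bsub>B\<^esub> left_translation Q (x <# H)
    = left_translation Q ((g \<otimes> x) <# H) \<otimes>\<^bsub>B\<^esub> act g"
  using assms
  by (intro Bij_eqI Bij_mult_closed)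
    (auto simp: act_Bij left_translation_in_Bij BijGroup_mult_apply act_coset
      left_translation_coset m_assoc inv_mult_group)

lemma left_translation_act:
  assumes "g \<in> carrier G" "x \<in> carrier G"
  shows "left_translation Q (x <# H) \<otimes>\<^bsub>B\<^esub> act (x \<otimes> g \<otimes> inv x)
    = act (x \<otimes> \<theta> g \<otimes> inv x) \<otimes>\<^bsub>B\<^esub> left_translation Q (x <# H)"
  using assms
  by (intro Bij_eqI Bij_mult_closed)
    (auto simp: act_Bij left_translation_in_Bij BijGroup_mult_apply act_coset
      left_translation_coset m_assoc)

lemma left_translation_eq_act:
  assumes "x \<in> carrier G"
  shows "left_translation Q (x <# H)
    = act (x \<otimes> inv (\<theta> x)) \<otimes>\<^bsub>B\<^esub> left_translation Q (\<one> <# H)"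
  using assms
  by (intro Bij_eqI Bij_mult_closed)
    (auto simp: act_Bij left_translation_in_Bij BijGroup_mult_apply act_coset
      left_translation_coset m_assoc)

lemma LMlt_is_subgroup: "subgroup (carrier (LMlt Q)) B"
  by (rule LMlt_subgroup[OF quandle_axioms])

lemma left_translation_in_LMlt:
  "x \<in> carrier G \<Longrightarrow> left_translation Q (x <# H) \<in> carrier (LMlt Q)"
  by (auto simp: LMlt_def intro!: generate.incl)

lemma act_in_LMlt:
  assumes gen: "generate G ((\<lambda>x. x \<otimes> inv (\<theta> x)) ` carrier G) = carrier G"
    and g: "g \<in> carrier G"
  shows "act g \<in> carrier (LMlt Q)"
proof -
  interpret S: subgroup "carrier (LMlt Q)" B by (rule LMlt_is_subgroup)
  let ?L = "\<lambda>x. left_translation Q (x <# H)"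
  have "act (x \<otimes> inv (\<theta> x)) \<in> carrier (LMlt Q)" if x: "x \<in> carrier G" for x
  proof -
    have "act (x \<otimes> inv (\<theta> x)) = ?L x \<otimes>\<^bsub>B\<^esub> inv\<^bsub>B\<^esub> (?L \<one>)"
      unfolding left_translation_eq_act[OF x]
      using x left_translation_in_LMlt[OF one_closed, THEN S.mem_carrier] by (simp add: B.m_assoc)
    then show ?thesis
      using x by (simp add: left_translation_in_LMlt)
  qed
  moreover have "subgroup {g \<in> carrier G. act g \<in> carrier (LMlt Q)} G"
    by (rule subgroupI) (auto intro!: exI[of _ \<one>] simp: act.hom_mult act.hom_inv)
  ultimately have "generate G ((\<lambda>x. x \<otimes> inv (\<theta> x)) ` carrier G)
      \<subseteq> {g \<in> carrier G. act g \<in> carrier (LMlt Q)}"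
    by (intro generate_subgroup_incl) auto
  with gen g show ?thesis by blast
qed

text \<open>Let \<open>K'\<close> be a subgroup of the left multiplication group above the stabilizer of \<open>xH\<close>. The
  elements \<open>g\<close> whose conjugate by \<open>x\<close> acts as an element of \<open>K'\<close> form a subgroup \<open>K\<close> above \<open>H\<close>. The left
  translation by \<open>xH\<close> fixes \<open>xH\<close>, hence lies in \<open>K'\<close>, and its conjugation action makes \<open>K\<close> stable under
  \<open>\<theta>\<close>. If \<open>K = H\<close> then \<open>K'\<close> is the stabilizer, and if \<open>K = G\<close> then \<open>K'\<close> contains all left translations.\<close>

lemma primitive_coset_quandleI:
  assumes gen: "generate G ((\<lambda>x. x \<otimes> inv (\<theta> x)) ` carrier G) = carrier G"
    and proper: "H \<noteq> carrier G"
    and max: "\<And>K. \<lbrakk>subgroup K G; H \<subseteq> K; \<And>g. g \<in> carrier G \<Longrightarrow> \<theta> g \<in> K \<longleftrightarrow> g \<in> K\<rbrakk>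
      \<Longrightarrow> K = H \<or> K = carrier G"
  shows "primitive_quandle Q"
proof -
  interpret S: subgroup "carrier (LMlt Q)" B by (rule LMlt_is_subgroup)
  let ?L = "\<lambda>x. left_translation Q (x <# H)"
  have Bij: "f \<in> Bij (carrier Q)" if "f \<in> carrier (LMlt Q)" for f
    using S.subset that by (auto simp: carrier_B)
  have transport: "act (y \<otimes> inv x) (x <# H) = y <# H"
    if "x \<in> carrier G" "y \<in> carrier G" for x y
    using that by (simp add: act_coset m_assoc)
  have "transitive_action (LMlt Q) (carrier Q) (\<lambda>f. f)"
  proof (intro transitive_action.intro transitive_action_axioms.intro group_action.intro
      group_hom.intro group_hom_axioms.intro)
    have M: "LMlt Q = B\<lparr>carrier := carrier (LMlt Q)\<rparr>" by (simp add: LMlt_def)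
    show "group (LMlt Q)"
      using S.subgroup_is_group[OF group_BijGroup] by (subst M)
    show "(\<lambda>f. f) \<in> hom (LMlt Q) B"
      using S.subset by (auto simp: hom_def LMlt_mult)
  next
    fix C D assume "C \<in> carrier Q" "D \<in> carrier Q"
    then obtain x y where "x \<in> carrier G" "y \<in> carrier G" "C = x <# H" "D = y <# H"
      by (auto simp: carrier_Q)
    then show "\<exists>f\<in>carrier (LMlt Q). f C = D"
      using transport act_in_LMlt[OF gen] by (metis inv_closed m_closed)
  qed (rule group_BijGroup)
  moreover have "maximal_subgroup (stabilizer (LMlt Q) (\<lambda>f. f) C) (LMlt Q)"
    if "C \<in> carrier Q" for C
  proof -
    from that obtain x where x: "x \<in> carrier G" and C: "C = x <# H" by (auto simp: carrier_Q)
    let ?St = "stabilizer (LMlt Q) (\<lambda>f. f) C"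
    have Lx: "?L x \<in> ?St"
      using x by (simp add: stabilizer_def C left_translation_in_LMlt left_translation_coset)
    have fixes_iff: "act (x \<otimes> g \<otimes> inv x) \<in> ?St \<longleftrightarrow> g \<in> H" if "g \<in> carrier G" for g
      using that x act_in_LMlt[OF gen]
      by (auto simp: stabilizer_def C act_coset m_assoc coset_eq_iff inv_mult_group H.m_inv_closed
          dest: H.m_inv_closed)
    have "?St \<noteq> carrier (LMlt Q)"
    proof -
      obtain g where "g \<in> carrier G" "g \<notin> H" using proper H.subset by blast
      then show ?thesis
        using fixes_iff[of g] act_in_LMlt[OF gen, of "x \<otimes> g \<otimes> inv x"] x by auto
    qed
    then have sub: "?St \<subset> carrier (LMlt Q)" by (auto simp: stabilizer_def)
    moreover have "K' = ?St \<or> K' = carrier (LMlt Q)"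
      if "subgroup K' B" and StK: "?St \<subseteq> K'" and KM: "K' \<subseteq> carrier (LMlt Q)" for K'
    proof -
      interpret K': subgroup K' B by fact
      define K where "K = {g \<in> carrier G. act (x \<otimes> g \<otimes> inv x) \<in> K'}"
      have conj_mult: "x \<otimes> (g \<otimes> h) \<otimes> inv x = (x \<otimes> g \<otimes> inv x) \<otimes> (x \<otimes> h \<otimes> inv x)"
        if "g \<in> carrier G" "h \<in> carrier G" for g h
        using that x by (simp add: m_assoc)
      have conj_inv: "x \<otimes> inv g \<otimes> inv x = inv (x \<otimes> g \<otimes> inv x)" if "g \<in> carrier G" for g
        using that x by (simp add: m_assoc inv_mult_group)
      have "subgroup K G"
      proof (rule subgroupI)
        show "K \<noteq> {}"
          using x K'.one_closed by (auto simp: K_def intro!: exI[of _ \<one>])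
        show "inv g \<in> K" if "g \<in> K" for g
          using that x by (simp add: K_def conj_inv act.hom_inv)
        show "g \<otimes> h \<in> K" if "g \<in> K" "h \<in> K" for g h
          using that x act.hom_mult[of "x \<otimes> g \<otimes> inv x" "x \<otimes> h \<otimes> inv x"]
          by (simp add: K_def conj_mult)
      qed (auto simp: K_def)
      moreover have "H \<subseteq> K"
        using StK fixes_iff H.subset by (auto simp: K_def)
      moreover have "\<theta> g \<in> K \<longleftrightarrow> g \<in> K" if g: "g \<in> carrier G" for g
      proof -
        note eq = left_translation_act[OF g x]
        have LK: "?L x \<in> K'" using Lx StK by blast
        have c: "act (x \<otimes> g \<otimes> inv x) \<in> carrier B" "act (x \<otimes> \<theta> g \<otimes> inv x) \<in> carrier B"
          using g x by simp_all
        have "act (x \<otimes> g \<otimes> inv x) \<in> K' \<longleftrightarrow> ?L x \<otimes>\<^bsub>B\<^esub> act (x \<otimes> g \<otimes> inv x) \<in> K'"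
          using LK c(1) K'.m_closed K'.m_inv_closed K'.mem_carrier
          by (metis B.inv_solve_left)
        moreover have "act (x \<otimes> \<theta> g \<otimes> inv x) \<in> K'
            \<longleftrightarrow> act (x \<otimes> \<theta> g \<otimes> inv x) \<otimes>\<^bsub>B\<^esub> ?L x \<in> K'"
          using LK c(2) K'.m_closed K'.m_inv_closed K'.mem_carrier
          by (metis B.inv_solve_right)
        ultimately show ?thesis using eq g by (simp add: K_def)
      qed
      ultimately consider "K = H" | "K = carrier G" using max by blast
      then show ?thesis
      proof cases
        case 1
        have "f \<in> ?St" if f: "f \<in> K'" for f
        proof -
          have fM: "f \<in> carrier (LMlt Q)" using f KM by blast
          have "f C \<in> carrier Q" by (rule Bij_apply_closed[OF Bij[OF fM] \<open>C \<in> carrier Q\<close>])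
          then obtain y where y: "y \<in> carrier G" "f C = y <# H" by (auto simp: carrier_Q)
          define s where "s = act (y \<otimes> inv x)"
          have s: "s \<in> carrier (LMlt Q)" using x y by (simp add: s_def act_in_LMlt[OF gen])
          \<comment> \<open>\<open>s\<close> carries \<open>C\<close> to \<open>f C\<close>, so \<open>f\<close> is \<open>s\<close> times an element of the stabilizer, and \<open>s \<in> K'\<close>.\<close>
          have si: "inv\<^bsub>B\<^esub> s = act (x \<otimes> inv y)" using x y by (simp add: s_def inv_mult_group flip: act.hom_inv)
          have "(inv\<^bsub>B\<^esub> s \<otimes>\<^bsub>B\<^esub> f) C = C"
            using x y(1) by (simp add: si BijGroup_mult_apply act_Bij Bij[OF fM] \<open>C \<in> carrier Q\<close> y(2))
              (simp add: C transport)
          then have "inv\<^bsub>B\<^esub> s \<otimes>\<^bsub>B\<^esub> f \<in> K'"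
            using StK s fM by (auto simp: stabilizer_def LMlt_mult)
          then have "f \<otimes>\<^bsub>B\<^esub> inv\<^bsub>B\<^esub> (inv\<^bsub>B\<^esub> s \<otimes>\<^bsub>B\<^esub> f) \<in> K'" using f by blast
          then have "s \<in> K'"
            using f[THEN K'.mem_carrier] s[THEN S.mem_carrier]
            by (simp add: B.inv_mult_group flip: B.m_assoc)
          then have "inv x \<otimes> y \<in> K"
            using x y by (simp add: K_def s_def)
          then have "C = f C" using 1 x y by (simp add: C coset_eq_iff)
          then show ?thesis using fM by (simp add: stabilizer_def)
        qed
        then show ?thesis using StK by blast
      next
        case 2
        have sh: "act g \<in> K'" if g: "g \<in> carrier G" for g
        proof -
          have "inv x \<otimes> g \<otimes> x \<in> K" using 2 g x by simp
          then show ?thesis using g x by (simp add: K_def m_assoc)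
        qed
        have "?L y \<in> K'" if y: "y \<in> carrier G" for y
        proof -
          let ?s = "act (y \<otimes> inv x)"
          have "?s \<otimes>\<^bsub>B\<^esub> ?L x = ?L y \<otimes>\<^bsub>B\<^esub> ?s"
            using act_left_translation[of "y \<otimes> inv x" x] x y by (simp add: m_assoc)
          then have "?L y = ?s \<otimes>\<^bsub>B\<^esub> ?L x \<otimes>\<^bsub>B\<^esub> inv\<^bsub>B\<^esub> ?s"
            using x y left_translation_in_LMlt[OF y, THEN S.mem_carrier] by (simp add: B.m_assoc)
          moreover have "?s \<otimes>\<^bsub>B\<^esub> ?L x \<otimes>\<^bsub>B\<^esub> inv\<^bsub>B\<^esub> ?s \<in> K'"
            using subsetD[OF StK Lx] sh x y by simp
          ultimately show ?thesis by (simp only:)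
        qed
        then have "left_translation Q ` carrier Q \<subseteq> K'"
          by (auto simp: carrier_Q)
        then have "carrier (LMlt Q) \<subseteq> K'"
          using B.generate_subgroup_incl[OF _ \<open>subgroup K' B\<close>] by (simp add: LMlt_def)
        then show ?thesis using KM by blast
      qed
    qed
    ultimately show ?thesis
      unfolding maximal_subgroup_LMlt_iff[OF quandle_axioms]
      using stabilizer_LMlt_subgroup[OF quandle_axioms \<open>C \<in> carrier Q\<close>] by blast
  qed
  ultimately show ?thesis
    by (simp add: primitive_quandle_def quandle_axioms)
qed

text \<open>For a \<open>\<theta>\<close>-stable \<open>K\<close>, lying in the same coset of \<open>K\<close> is a congruence of the quandle, because
  multiplying \<open>yH\<close> and \<open>zH\<close> by \<open>xH\<close> replaces \<open>y\<^sup>-\<^sup>1z\<close> by \<open>\<theta>(y\<^sup>-\<^sup>1z)\<close>.\<close>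

lemma primitive_coset_quandleD:
  assumes prim: "primitive_quandle Q"
  shows "H \<noteq> carrier G"
    and "\<lbrakk>subgroup K G; H \<subseteq> K; \<And>g. g \<in> carrier G \<Longrightarrow> \<theta> g \<in> K \<longleftrightarrow> g \<in> K\<rbrakk>
      \<Longrightarrow> K = H \<or> K = carrier G"
proof -
  show "H \<noteq> carrier G"
  proof
    assume "H = carrier G"
    then have "x <# H = H" if "x \<in> carrier G" for x
      using coset_join3[OF that H] that by blast
    then have "carrier Q = {H}"
      unfolding carrier_Q using one_closed by blast
    then show False using primitive_quandle_not_singleton[OF prim] by blast
  qed
next
  assume K: "subgroup K G" "H \<subseteq> K" and st: "\<And>g. g \<in> carrier G \<Longrightarrow> \<theta> g \<in> K \<longleftrightarrow> g \<in> K"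
  interpret K: subgroup K G by fact
  define R where "R = {(x <# H, y <# H) | x y. x \<in> carrier G \<and> y \<in> carrier G \<and> inv x \<otimes> y \<in> K}"
  have R_iff: "(x <# H, y <# H) \<in> R \<longleftrightarrow> inv x \<otimes> y \<in> K"
    if xy: "x \<in> carrier G" "y \<in> carrier G" for x y
  proof
    assume "(x <# H, y <# H) \<in> R"
    then obtain x' y' where *: "x' \<in> carrier G" "y' \<in> carrier G" "inv x' \<otimes> y' \<in> K"
      and eq: "x <# H = x' <# H" "y' <# H = y <# H" unfolding R_def by blast
    have "inv x \<otimes> x' \<in> K" "inv y' \<otimes> y \<in> K"
      using eq * xy K(2) by (auto simp: coset_eq_iff)
    then have "(inv x \<otimes> x') \<otimes> (inv x' \<otimes> y') \<otimes> (inv y' \<otimes> y) \<in> K" using * by blast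
    then show "inv x \<otimes> y \<in> K" using * xy by (simp add: m_assoc)
  qed (use xy in \<open>auto simp: R_def\<close>)
  have "equiv (carrier Q) R"
  proof (rule equivI)
    show "R \<subseteq> carrier Q \<times> carrier Q" by (auto simp: R_def)
    show "refl_on (carrier Q) R" by (auto simp: refl_on_def carrier_Q R_iff)
    show "sym R"
    proof (rule symI)
      fix C D assume "(C, D) \<in> R"
      then obtain x y where xy: "x \<in> carrier G" "y \<in> carrier G" "inv x \<otimes> y \<in> K"
        and CD: "C = x <# H" "D = y <# H" unfolding R_def by blast
      then have "inv (inv x \<otimes> y) \<in> K" by blast
      then show "(D, C) \<in> R" using xy by (simp add: CD R_iff inv_mult_group)
    qed
    show "trans R"
    proof (rule transI)
      fix C D E assume "(C, D) \<in> R" "(D, E) \<in> R"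
      moreover from this obtain x y z where xyz: "x \<in> carrier G" "y \<in> carrier G" "z \<in> carrier G"
        and CDE: "C = x <# H" "D = y <# H" "E = z <# H" unfolding R_def by blast
      ultimately have "(inv x \<otimes> y) \<otimes> (inv y \<otimes> z) \<in> K" by (simp add: R_iff)
      then show "(C, E) \<in> R" using xyz by (simp add: CDE R_iff m_assoc)
    qed
  qed
  moreover have "(C \<star>\<^bsub>Q\<^esub> D, C \<star>\<^bsub>Q\<^esub> E) \<in> R \<longleftrightarrow> (D, E) \<in> R"
    if "C \<in> carrier Q" "D \<in> carrier Q" "E \<in> carrier Q" for C D E
  proof -
    from that obtain x y z where xyz: "x \<in> carrier G" "y \<in> carrier G" "z \<in> carrier G"
      and CDE: "C = x <# H" "D = y <# H" "E = z <# H" by (auto simp: carrier_Q)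
    have "inv (x \<otimes> \<theta> (inv x \<otimes> y)) \<otimes> (x \<otimes> \<theta> (inv x \<otimes> z)) = \<theta> (inv y \<otimes> z)"
      using xyz by (simp add: inv_mult_group m_assoc)
    then show ?thesis
      using xyz st[of "inv y \<otimes> z"]
      by (simp add: CDE coset_quandle_mult[OF is_group H H_Fix \<theta>] R_iff del: theta.hom_mult)
  qed
  ultimately have "R = Id_on (carrier Q) \<or> R = carrier Q \<times> carrier Q"
    by (rule primitive_quandle_congruence[OF prim])
  then show "K = H \<or> K = carrier G"
  proof
    assume Id: "R = Id_on (carrier Q)"
    have "g \<in> H" if g: "g \<in> K" for g
    proof -
      have "(\<one> <# H, g <# H) \<in> R" using g by (simp add: R_iff)
      then have "\<one> <# H = g <# H" using Id by blast
      then show ?thesis using g by (simp add: coset_eq_iff)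
    qed
    with K(2) show ?thesis by blast
  next
    assume "R = carrier Q \<times> carrier Q"
    then have "g \<in> K" if "g \<in> carrier G" for g
      using R_iff[of \<one> g] that by simp
    then show ?thesis using K.subset by blast
  qed
qed

end


section \<open>Nonabelian simple groups\<close>

lemma (in group) commutator_eq_one_iff:
  assumes "a \<in> carrier G" "b \<in> carrier G"
  shows "a \<otimes> b \<otimes> inv a \<otimes> inv b = \<one> \<longleftrightarrow> a \<otimes> b = b \<otimes> a"
proof -
  have "a \<otimes> b \<otimes> inv a \<otimes> inv b = (a \<otimes> b) \<otimes> inv (b \<otimes> a)"
    using assms by (simp add: inv_mult_group m_assoc)
  then show ?thesis
    using assms inv_solve_right'[of \<one> "a \<otimes> b" "b \<otimes> a"] by simp
qed

lemma (in group) subgroup_centralizer: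
  assumes y: "y \<in> carrier G"
  shows "subgroup {h \<in> carrier G. h \<otimes> y = y \<otimes> h} G" (is "subgroup ?Z G")
proof (rule subgroupI)
  fix h assume h: "h \<in> ?Z"
  then have hc: "h \<in> carrier G" by simp
  have "inv h \<otimes> (h \<otimes> y) \<otimes> inv h = inv h \<otimes> (y \<otimes> h) \<otimes> inv h" using h by simp
  moreover have "inv h \<otimes> (h \<otimes> y) \<otimes> inv h = y \<otimes> inv h" using hc y by (simp add: m_assoc) (simp flip: m_assoc)
  moreover have "inv h \<otimes> (y \<otimes> h) \<otimes> inv h = inv h \<otimes> y" using hc y by (simp add: m_assoc)
  ultimately show "inv h \<in> ?Z" using h by simp
next
  fix h k assume hk: "h \<in> ?Z" "k \<in> ?Z"
  then have hkc: "h \<in> carrier G" "k \<in> carrier G" by simp_all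
  have "(h \<otimes> k) \<otimes> y = h \<otimes> (k \<otimes> y)" using hkc y by (simp add: m_assoc)
  also have "\<dots> = h \<otimes> (y \<otimes> k)" using hk by simp
  also have "\<dots> = (h \<otimes> y) \<otimes> k" using hkc y by (simp add: m_assoc)
  also have "\<dots> = (y \<otimes> h) \<otimes> k" using hk by simp
  also have "\<dots> = y \<otimes> (h \<otimes> k)" using hkc y by (simp add: m_assoc)
  finally show "h \<otimes> k \<in> ?Z" using hk by simp
qed (use y in \<open>auto intro!: exI[of _ \<one>]\<close>)

context simple_group
begin

lemma derived_eq_carrier:
  assumes "\<not> comm_group G"
  shows "derived G (carrier G) = carrier G"
proof (rule ccontr)
  assume "derived G (carrier G) \<noteq> carrier G"
  then have D: "derived G (carrier G) = {\<one>}"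
    using no_real_normal_subgroup[OF derived_self_is_normal] by blast
  have "a \<otimes> b = b \<otimes> a" if ab: "a \<in> carrier G" "b \<in> carrier G" for a b
  proof -
    have "a \<otimes> b \<otimes> inv a \<otimes> inv b \<in> derived G (carrier G)"
      unfolding derived_def using ab by (intro generate.incl) blast
    then have "a \<otimes> b \<otimes> inv a \<otimes> inv b = \<one>" using D by blast
    then show ?thesis using commutator_eq_one_iff[OF ab] by simp
  qed
  then have "comm_group G" by (intro group_comm_groupI) blast
  with assms show False by contradiction
qed

lemma generate_conjugates:
  assumes "z \<in> carrier G" "z \<noteq> \<one>"
  shows "generate G ((\<lambda>g. g \<otimes> z \<otimes> inv g) ` carrier G) = carrier G" (is "generate G ?C = _")
proof -
  have "generate G ?C \<lhd> G"
  proof (rule normal_generateI)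
    fix h g assume "h \<in> ?C" and g: "g \<in> carrier G"
    then obtain k where k: "k \<in> carrier G" "h = k \<otimes> z \<otimes> inv k" by blast
    then have "g \<otimes> h \<otimes> inv g = (g \<otimes> k) \<otimes> z \<otimes> inv (g \<otimes> k)"
      using g assms by (simp add: inv_mult_group m_assoc)
    then show "g \<otimes> h \<otimes> inv g \<in> ?C" using g k by blast
  qed (use assms in auto)
  moreover have "z \<in> generate G ?C"
    using assms by (intro generate.incl image_eqI[of _ _ \<one>]) auto
  ultimately show ?thesis
    using no_real_normal_subgroup[of "generate G ?C"] assms(2) by blast
qed

text \<open>The only conjugate of a central element is itself, so if it is nontrivial it generates the
  group by simplicity, and the group is abelian.\<close>

lemma centre_trivial:
  assumes "\<not> comm_group G" "y \<in> carrier G"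
    and "\<And>g. g \<in> carrier G \<Longrightarrow> g \<otimes> y = y \<otimes> g"
  shows "y = \<one>"
proof (rule ccontr)
  assume y: "y \<noteq> \<one>"
  have "g \<otimes> y \<otimes> inv g = y" if "g \<in> carrier G" for g
  proof -
    have "g \<otimes> y \<otimes> inv g = y \<otimes> g \<otimes> inv g" by (simp only: assms(3)[OF that])
    then show ?thesis using assms(2) that by (simp add: m_assoc)
  qed
  then have "(\<lambda>g. g \<otimes> y \<otimes> inv g) ` carrier G = (\<lambda>_. y) ` carrier G"
    by (intro image_cong refl)
  also have "\<dots> = {y}"
    using one_closed by (rule image_constant)
  finally have "(\<lambda>g. g \<otimes> y \<otimes> inv g) ` carrier G = {y}" .
  then have gen: "generate G {y} = carrier G"
    using generate_conjugates[OF assms(2) y] by simp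
  have "a \<otimes> b = b \<otimes> a" if "a \<in> carrier G" "b \<in> carrier G" for a b
  proof -
    have "generate G {y} \<subseteq> {h \<in> carrier G. h \<otimes> b = b \<otimes> h}"
      using assms(2) assms(3)[OF that(2)]
      by (intro generate_subgroup_incl subgroup_centralizer that(2)) simp
    then show ?thesis using gen that(1) by blast
  qed
  then have "comm_group G" by (intro group_comm_groupI) blast
  with assms(1) show False by contradiction
qed

text \<open>The conjugates of \<open>z\<close> generate the group, so an element that commutes with all of them is central.
  Stated with commutators, this supplies the inductive step of \<open>separating_subgroup_eq_carrier\<close>.\<close>

lemma exists_noncommuting_conjugate:
  assumes "\<not> comm_group G" "y \<in> carrier G" "y \<noteq> \<one>" "z \<in> carrier G" "z \<noteq> \<one>"
  shows "\<exists>g\<in>carrier G. y \<otimes> (g \<otimes> z \<otimes> inv g) \<otimes> inv y \<otimes> inv (g \<otimes> z \<otimes> inv g) \<noteq> \<one>"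
proof (rule ccontr)
  assume contr: "\<not> ?thesis"
  have com: "(g \<otimes> z \<otimes> inv g) \<otimes> y = y \<otimes> (g \<otimes> z \<otimes> inv g)" if g: "g \<in> carrier G" for g
  proof -
    let ?w = "g \<otimes> z \<otimes> inv g"
    have w: "?w \<in> carrier G" using g assms by simp
    have "y \<otimes> ?w \<otimes> inv y \<otimes> inv ?w = \<one>"
      using contr g by blast
    then show ?thesis using commutator_eq_one_iff[OF assms(2) w] by simp
  qed
  have "(\<lambda>g. g \<otimes> z \<otimes> inv g) ` carrier G \<subseteq> {h \<in> carrier G. h \<otimes> y = y \<otimes> h}"
    using com assms(4) by auto
  then have "generate G ((\<lambda>g. g \<otimes> z \<otimes> inv g) ` carrier G) \<subseteq> {h \<in> carrier G. h \<otimes> y = y \<otimes> h}"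
    by (rule generate_subgroup_incl[OF _ subgroup_centralizer[OF assms(2)]])
  then have "carrier G \<subseteq> {h \<in> carrier G. h \<otimes> y = y \<otimes> h}"
    unfolding generate_conjugates[OF assms(4,5)] .
  then have "y = \<one>" by (intro centre_trivial[OF assms(1,2)]) blast
  with assms(3) show False by contradiction
qed

end

section \<open>Powers of a group and the cyclic shift\<close>

locale group_power = group L for L (structure) +
  fixes t :: nat
begin

abbreviation P where "P \<equiv> power_group L t"

abbreviation \<sigma> where "\<sigma> \<equiv> shift_auto t L (\<lambda>x\<in>carrier L. x)"

definition single :: "nat \<Rightarrow> 'a \<Rightarrow> nat \<Rightarrow> 'a" where
  "single i a = (\<lambda>j\<in>{..<t}. if j = i then a else \<one>)"

definition diag :: "'a \<Rightarrow> nat \<Rightarrow> 'a" where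
  "diag a = (\<lambda>j\<in>{..<t}. a)"

sublocale P: group P by (rule group_power_group[OF is_group])

lemma carrier_P: "carrier P = {..<t} \<rightarrow>\<^sub>E carrier L"
  by (simp add: power_group_def)

lemma P_app_closed [simp]: "x \<in> carrier P \<Longrightarrow> i < t \<Longrightarrow> x i \<in> carrier L"
  by (auto simp: carrier_P)

lemma P_one_app [simp]: "i < t \<Longrightarrow> \<one>\<^bsub>P\<^esub> i = \<one>"
  by (simp add: power_group_def)

lemma P_mult_app [simp]: "i < t \<Longrightarrow> (x \<otimes>\<^bsub>P\<^esub> y) i = x i \<otimes> y i"
  by (simp add: power_group_def)

lemma P_inv_app [simp]: "x \<in> carrier P \<Longrightarrow> i < t \<Longrightarrow> (inv\<^bsub>P\<^esub> x) i = inv (x i)"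
  unfolding power_group_def by (subst inv_product_group) (auto simp: is_group)

lemma P_eqI:
  assumes "x \<in> carrier P" "y \<in> carrier P" "\<And>i. i < t \<Longrightarrow> x i = y i"
  shows "x = y"
  by (rule PiE_ext[OF assms(1,2)[unfolded carrier_P]]) (simp add: assms(3))

lemma single_closed [simp]: "a \<in> carrier L \<Longrightarrow> single i a \<in> carrier P"
  by (auto simp: single_def carrier_P)

lemma diag_closed [simp]: "a \<in> carrier L \<Longrightarrow> diag a \<in> carrier P"
  by (auto simp: diag_def carrier_P)

lemma single_app [simp]: "j < t \<Longrightarrow> single i a j = (if j = i then a else \<one>)"
  by (simp add: single_def)

lemma diag_app [simp]: "j < t \<Longrightarrow> diag a j = a"
  by (simp add: diag_def)

lemma diag_fix_eq: "diag_fix t L (\<lambda>x\<in>carrier L. x) = diag ` carrier L"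
  by (auto simp: diag_fix_def Fix_def diag_def)

lemma single_hom: "group_hom L P (single i)"
proof (intro group_hom.intro group_hom_axioms.intro homI)
  fix a b assume "a \<in> carrier L" "b \<in> carrier L"
  then show "single i (a \<otimes> b) = single i a \<otimes>\<^bsub>P\<^esub> single i b"
    by (intro P_eqI) simp_all
qed (simp_all add: is_group P.is_group)

lemma subgroup_single_vimage:
  assumes "subgroup K P"
  shows "subgroup {a \<in> carrier L. single i a \<in> K} L"
proof -
  interpret K: subgroup K P by fact
  interpret s: group_hom L P "single i" by (rule single_hom)
  show ?thesis
  proof (rule subgroupI)
    have "\<one> \<in> {a \<in> carrier L. single i a \<in> K}" using s.hom_one by simp
    then show "{a \<in> carrier L. single i a \<in> K} \<noteq> {}" by blast
  qed (simp_all add: subset_iff)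
qed

lemma subgroup_eq_carrierI:
  assumes "subgroup K P" and single: "\<And>i a. i < t \<Longrightarrow> a \<in> carrier L \<Longrightarrow> single i a \<in> K"
  shows "K = carrier P"
proof
  interpret K: subgroup K P by fact
  show "K \<subseteq> carrier P" by (rule K.subset)
  show "carrier P \<subseteq> K"
  proof
    fix x assume x: "x \<in> carrier P"
    define y where "y n = (\<lambda>j\<in>{..<t}. if j < n then x j else \<one>)" for n
    have y_closed: "y n \<in> carrier P" for n using x by (auto simp: y_def carrier_P)
    have "n \<le> t \<Longrightarrow> y n \<in> K" for n
    proof (induction n)
      case 0
      have "y 0 = \<one>\<^bsub>P\<^esub>" by (intro P_eqI y_closed) (auto simp: y_def)
      then show ?case by simp
    next
      case (Suc n)
      have "y (Suc n) = y n \<otimes>\<^bsub>P\<^esub> single n (x n)"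
        using x Suc.prems by (intro P_eqI y_closed P.m_closed single_closed) (auto simp: y_def)
      with Suc x show ?case by (simp add: single)
    qed
    then have "y t \<in> K" by blast
    moreover have "y t = x" using x by (intro P_eqI y_closed) (auto simp: y_def)
    ultimately show "x \<in> K" by simp
  qed
qed

lemma shift_in_auto: "\<sigma> \<in> auto P"
  by (rule shift_auto_in_auto[OF is_group id_in_auto])

lemma shift_closed [simp]: "x \<in> carrier P \<Longrightarrow> \<sigma> x \<in> carrier P"
  using shift_in_auto by (auto simp: auto_def hom_def)

text \<open>Adding \<open>t - 1\<close> stands for subtracting \<open>1\<close> modulo \<open>t\<close>, which avoids truncated subtraction.\<close>

lemma shift_app:
  assumes "x \<in> carrier P" "i < t"
  shows "\<sigma> x i = x ((i + (t - 1)) mod t)"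
proof (cases i)
  case 0
  then show ?thesis using assms by (simp add: shift_auto_def)
next
  case (Suc k)
  then have "(i + (t - 1)) mod t = k" using assms by simp
  then show ?thesis using assms Suc by (simp add: shift_auto_def)
qed

lemma shift_app_Suc:
  assumes "x \<in> carrier P" "i < t"
  shows "\<sigma> x (Suc i mod t) = x i"
proof (cases "Suc i = t")
  case True
  then show ?thesis using assms by (auto simp: shift_auto_def)
next
  case False
  then show ?thesis using assms by (simp add: shift_auto_def)
qed

lemma cyclic_predecessor:
  assumes "j < t"
  obtains i where "i < t" "Suc i mod t = j" "t \<ge> 2 \<Longrightarrow> i \<noteq> j"
  using assms by (intro that[of "if j = 0 then t - 1 else j - 1"]) auto

lemma shift_single:
  assumes "i < t" "a \<in> carrier L"
  shows "\<sigma> (single i a) = single (Suc i mod t) a"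
proof (rule P_eqI)
  fix j assume j: "j < t"
  obtain k where k: "k < t" "j = Suc k mod t"
    by (rule cyclic_predecessor[OF j]) simp
  moreover have "Suc k mod t = Suc i mod t \<longleftrightarrow> k = i"
    using assms(1) k(1) by (auto simp: mod_Suc split: if_splits)
  ultimately show "\<sigma> (single i a) j = single (Suc i mod t) a j"
    using assms j by (simp add: shift_app_Suc)
qed (use assms in auto)

text \<open>The quotient of the tuple with single entry \<open>b\<close> at \<open>i\<close> by its shift has the entries \<open>b\<close> at \<open>i\<close> and
  \<open>b\<^sup>-\<^sup>1\<close> at the next index \<open>j \<noteq> i\<close>. In the first of these entries it is multiplicative in \<open>b\<close>, in the second
  antimultiplicative, so comparing the product of two quotients with the quotient of the product
  leaves a commutator at \<open>j\<close> alone. Commutators generate a perfect group.\<close>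

lemma generate_shift_quotients:
  assumes perfect: "derived L (carrier L) = carrier L" and t: "t \<ge> 2"
  shows "generate P ((\<lambda>x. x \<otimes>\<^bsub>P\<^esub> inv\<^bsub>P\<^esub> (\<sigma> x)) ` carrier P) = carrier P" (is "?D = _")
proof (rule subgroup_eq_carrierI)
  show D: "subgroup ?D P" by (rule P.generate_is_subgroup) auto
  interpret D: subgroup ?D P by (rule D)
  fix j a assume j: "j < t" and a: "a \<in> carrier L"
  obtain i where i: "i < t" "i \<noteq> j" "Suc i mod t = j"
    using cyclic_predecessor[OF j] t by blast
  define d where "d b = single i b \<otimes>\<^bsub>P\<^esub> inv\<^bsub>P\<^esub> single j b" for b
  have d_closed: "d b \<in> carrier P" if "b \<in> carrier L" for b
    using that by (simp add: d_def)
  have d_app: "d b k = (if k = i then b else if k = j then inv b else \<one>)"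
    if "b \<in> carrier L" "k < t" for b k
    using that i(2) by (simp add: d_def)
  have d: "d b \<in> ?D" if "b \<in> carrier L" for b
  proof -
    have "d b = single i b \<otimes>\<^bsub>P\<^esub> inv\<^bsub>P\<^esub> (\<sigma> (single i b))"
      using shift_single[OF i(1) that] i(3) by (simp add: d_def)
    then show ?thesis
      by (intro generate.incl image_eqI[of _ _ "single i b"]) (use that in simp_all)
  qed
  have "derived_set L (carrier L) \<subseteq> {b \<in> carrier L. single j b \<in> ?D}"
  proof
    fix e assume "e \<in> derived_set L (carrier L)"
    then obtain b c where bc: "b \<in> carrier L" "c \<in> carrier L" and e: "e = b \<otimes> c \<otimes> inv b \<otimes> inv c"
      by blast
    have "single j (b \<otimes> c \<otimes> inv b \<otimes> inv c)
        = d (inv b) \<otimes>\<^bsub>P\<^esub> d (inv c) \<otimes>\<^bsub>P\<^esub> inv\<^bsub>P\<^esub> (d (inv b \<otimes> inv c))" (is "_ = ?r")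
    proof (rule P_eqI)
      fix k assume k: "k < t"
      have "?r k = d (inv b) k \<otimes> d (inv c) k \<otimes> inv (d (inv b \<otimes> inv c) k)"
        using k bc d_closed by simp
      then show "single j (b \<otimes> c \<otimes> inv b \<otimes> inv c) k = ?r k"
        using i(2) k bc m_assoc[of "b \<otimes> c" "inv b" "inv c"] by (simp add: d_app)
    qed (use bc d_closed in simp_all)
    also have "\<dots> \<in> ?D" using bc by (intro D.m_closed D.m_inv_closed d) simp_all
    finally show "e \<in> {b \<in> carrier L. single j b \<in> ?D}" unfolding e using bc by simp
  qed
  then have "derived L (carrier L) \<subseteq> {b \<in> carrier L. single j b \<in> ?D}"
    unfolding derived_def by (rule generate_subgroup_incl[OF _ subgroup_single_vimage[OF D]])
  then have "a \<in> {b \<in> carrier L. single j b \<in> ?D}" unfolding perfect using a by (rule subsetD)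
  then show "single j a \<in> ?D" by simp
qed

text \<open>To isolate the coordinate \<open>i\<close>, an element nontrivial at \<open>i\<close> is made trivial at the other
  coordinates one after another. Suppose \<open>y\<close> is trivial on \<open>S\<close>. Since \<open>K\<close> separates \<open>i\<close> from \<open>j\<close> and contains the
  diagonal, it has an element \<open>z\<close> trivial at \<open>j\<close> but not at \<open>i\<close>. A commutator of \<open>y\<close> with a diagonal conjugate
  of \<open>z\<close> is trivial on \<open>S\<close> and at \<open>j\<close>, and the conjugating element can be chosen to keep it nontrivial
  at \<open>i\<close>. Once an element is concentrated at \<open>i\<close>, its diagonal conjugates generate that whole factor.\<close>

lemma separating_subgroup_eq_carrier:
  assumes simple: "simple_group L" and nonab: "\<not> comm_group L"
    and K: "subgroup K P" and diag: "diag ` carrier L \<subseteq> K"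
    and sep: "\<And>i j. \<lbrakk>i < t; j < t; i \<noteq> j\<rbrakk> \<Longrightarrow> \<exists>x\<in>K. x i \<noteq> x j"
  shows "K = carrier P"
proof (rule subgroup_eq_carrierI[OF K])
  interpret simple_group L by fact
  interpret K: subgroup K P by fact
  have diagK [simp]: "diag a \<in> K" if "a \<in> carrier L" for a using diag that by blast
  fix i a assume i: "i < t" and a: "a \<in> carrier L"
  have "\<exists>x\<in>K. x i \<noteq> \<one> \<and> (\<forall>j\<in>S. x j = \<one>)" if "finite S" "S \<subseteq> {..<t} - {i}" for S
    using that
  proof (induction S)
    case empty
    obtain b where "b \<in> carrier L" "b \<noteq> \<one>" using simple_not_triv by blast
    then show ?case using diag i by (auto intro!: bexI[of _ "diag b"])
  next
    case (insert j S)
    then obtain y where y: "y \<in> K" "y i \<noteq> \<one>" "\<And>k. k \<in> S \<Longrightarrow> y k = \<one>" by auto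
    have j: "j < t" "j \<noteq> i" using insert.prems by auto
    with sep[OF i j(1)] obtain x where x: "x \<in> K" "x i \<noteq> x j" by auto
    define z where "z = x \<otimes>\<^bsub>P\<^esub> inv\<^bsub>P\<^esub> (diag (x j))"
    have zK: "z \<in> K" using x j by (simp add: z_def)
    have zj: "z j = \<one>" using x j by (simp add: z_def)
    have zi: "z i \<noteq> \<one>" using x i j inv_solve_right'[of \<one> "x i" "x j"] by (auto simp: z_def)
    have "y i \<in> carrier L" "z i \<in> carrier L" using y(1) zK i by simp_all
    then obtain g where g: "g \<in> carrier L"
      "y i \<otimes> (g \<otimes> z i \<otimes> inv g) \<otimes> inv (y i) \<otimes> inv (g \<otimes> z i \<otimes> inv g) \<noteq> \<one>"
      using exists_noncommuting_conjugate[OF nonab _ y(2) _ zi] by blast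
    define w where "w = diag g \<otimes>\<^bsub>P\<^esub> z \<otimes>\<^bsub>P\<^esub> inv\<^bsub>P\<^esub> (diag g)"
    have wK: "w \<in> K" using zK g(1) by (simp add: w_def)
    have w_app: "w k = g \<otimes> z k \<otimes> inv g" if "k < t" for k
      using that zK g(1) by (simp add: w_def)
    let ?c = "y \<otimes>\<^bsub>P\<^esub> w \<otimes>\<^bsub>P\<^esub> inv\<^bsub>P\<^esub> y \<otimes>\<^bsub>P\<^esub> inv\<^bsub>P\<^esub> w"
    have c_app: "?c k = y k \<otimes> w k \<otimes> inv (y k) \<otimes> inv (w k)" if "k < t" for k
      using that y(1) wK by simp
    have "?c \<in> K" using y(1) wK by simp
    moreover have "?c i \<noteq> \<one>" using c_app[OF i] w_app[OF i] g(2) by simp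
    moreover have "?c j = \<one>"
      using c_app[OF j(1)] w_app[OF j(1)] zj g(1) y(1) j(1) by simp
    moreover have "?c k = \<one>" if "k \<in> S" for k
    proof -
      have "k < t" using that insert.prems by auto
      then show ?thesis using c_app[of k] y(3)[OF that] wK by simp
    qed
    ultimately show ?case by (intro bexI[of _ ?c]) auto
  qed
  from this[of "{..<t} - {i}"] obtain x where x: "x \<in> K" "x i \<noteq> \<one>"
    and x1: "\<And>j. j < t \<Longrightarrow> j \<noteq> i \<Longrightarrow> x j = \<one>" by auto
  have xi: "x i \<in> carrier L" using x i by simp
  have "single i (g \<otimes> x i \<otimes> inv g) \<in> K" if g: "g \<in> carrier L" for g
  proof -
    have "single i (g \<otimes> x i \<otimes> inv g) = diag g \<otimes>\<^bsub>P\<^esub> x \<otimes>\<^bsub>P\<^esub> inv\<^bsub>P\<^esub> (diag g)"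
      using x g xi by (intro P_eqI) (auto simp: x1)
    then show ?thesis using x g by simp
  qed
  then have "(\<lambda>g. g \<otimes> x i \<otimes> inv g) ` carrier L \<subseteq> {b \<in> carrier L. single i b \<in> K}"
    using xi by auto
  then have "generate L ((\<lambda>g. g \<otimes> x i \<otimes> inv g) ` carrier L) \<subseteq> {b \<in> carrier L. single i b \<in> K}"
    by (rule generate_subgroup_incl[OF _ subgroup_single_vimage[OF K]])
  then show "single i a \<in> K" using generate_conjugates[OF xi x(2)] a by blast
qed

text \<open>If the coordinates \<open>i\<close> and \<open>j\<close> agree on \<open>K\<close>, so do any two at distance \<open>d = j - i\<close> modulo \<open>t\<close>, by
  stability. As \<open>d\<close> is invertible modulo the prime \<open>t\<close>, steps of length \<open>d\<close> starting from \<open>0\<close> visit every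
  index.\<close>

lemma prime_shift_stable_subgroup:
  assumes prime: "prime t" and K: "subgroup K P" and diag: "diag ` carrier L \<subseteq> K"
    and stable: "\<And>x. x \<in> carrier P \<Longrightarrow> \<sigma> x \<in> K \<longleftrightarrow> x \<in> K"
    and ij: "i < j" "j < t" and eq: "\<And>x. x \<in> K \<Longrightarrow> x i = x j"
  shows "K = diag ` carrier L"
proof -
  interpret K: subgroup K P by fact
  have t: "t > 0" using ij by simp
  have shifted: "x ((i + m) mod t) = x ((j + m) mod t)" if "x \<in> K" for x m
    using that
  proof (induction m arbitrary: x)
    case 0
    then show ?case using ij eq by simp
  next
    case (Suc m)
    have x: "x \<in> carrier P" using Suc.prems by simp
    have "\<sigma> ` carrier P = carrier P"
      using shift_in_auto by (auto simp: auto_def Bij_def bij_betw_def)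
    then obtain y where y: "y \<in> carrier P" "\<sigma> y = x" using x by (metis imageE)
    then have "y \<in> K" using stable Suc.prems by blast
    then have "y ((i + m) mod t) = y ((j + m) mod t)" by (rule Suc.IH)
    then have "x (Suc ((i + m) mod t) mod t) = x (Suc ((j + m) mod t) mod t)"
      using shift_app_Suc[OF y(1)] y(2) t by simp
    then show ?case by (simp add: mod_Suc_eq)
  qed
  define d where "d = j - i"
  have step: "x (k mod t) = x ((k + d) mod t)" if "x \<in> K" for x k
  proof -
    have "(i + (k + (t - i))) mod t = k mod t"
      using ij by (simp add: add.commute)
    moreover have "(j + (k + (t - i))) mod t = (k + d) mod t"
    proof -
      have "j + (k + (t - i)) = (k + d) + t" using ij by (simp add: d_def)
      then have "(j + (k + (t - i))) mod t = ((k + d) + t) mod t" by (simp only:)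
      then show ?thesis by simp
    qed
    ultimately show ?thesis using shifted[OF that, of "k + (t - i)"] by simp
  qed
  have multiples: "x ((n * d) mod t) = x 0" if "x \<in> K" for x n
  proof (induction n)
    case (Suc n)
    then show ?case using step[OF that, of "n * d"] by (simp add: add.commute)
  qed simp
  have "\<not> t dvd d" using ij by (auto simp: d_def dest: dvd_imp_le)
  then have "coprime d t" using prime_imp_coprime[OF prime] by (simp add: coprime_commute)
  then obtain e where e: "[d * e = 1] (mod t)" using cong_solve_coprime_nat by (metis One_nat_def)
  have "x = diag (x 0)" if x: "x \<in> K" for x
  proof (rule P_eqI)
    fix k assume k: "k < t"
    have "[k * e * d = k] (mod t)"
      using cong_scalar_left[OF e, of k] by (simp add: ac_simps)
    then have "(k * e * d) mod t = k" using k by (simp add: cong_def)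
    then show "x k = diag (x 0) k" using multiples[OF x, of "k * e"] k by simp
  qed (use x t in auto)
  then have "K \<subseteq> diag ` carrier L" using t by (auto intro!: image_eqI[of _ diag])
  with diag show ?thesis by blast
qed

text \<open>Equality of entries at congruent indices makes the symmetry under rotation more direct than
  the equation \<open>x i = x (i + r)\<close>, whose right side may leave the index range.\<close>

definition periodic :: "nat \<Rightarrow> (nat \<Rightarrow> 'a) set" where
  "periodic r = {x \<in> carrier P. \<forall>i<t. \<forall>j<t. i mod r = j mod r \<longrightarrow> x i = x j}"

lemma periodicI:
  "\<lbrakk>x \<in> carrier P; \<And>i j. \<lbrakk>i < t; j < t; i mod r = j mod r\<rbrakk> \<Longrightarrow> x i = x j\<rbrakk> \<Longrightarrow> x \<in> periodic r"
  unfolding periodic_def by blast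

lemma periodic_closed: "x \<in> periodic r \<Longrightarrow> x \<in> carrier P"
  unfolding periodic_def by blast

lemma periodicD:
  "\<lbrakk>x \<in> periodic r; i < t; j < t; i mod r = j mod r\<rbrakk> \<Longrightarrow> x i = x j"
  unfolding periodic_def by blast

lemma periodic_subgroup: "subgroup (periodic r) P"
proof (rule P.subgroupI)
  have "\<one>\<^bsub>P\<^esub> \<in> periodic r" by (simp add: periodic_def)
  then show "periodic r \<noteq> {}" by blast
next
  fix x assume x: "x \<in> periodic r"
  show "inv\<^bsub>P\<^esub> x \<in> periodic r"
  proof (rule periodicI)
    fix i j assume ij: "i < t" "j < t" "i mod r = j mod r"
    show "(inv\<^bsub>P\<^esub> x) i = (inv\<^bsub>P\<^esub> x) j"
      using ij(1,2) periodicD[OF x ij] periodic_closed[OF x] by simp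
  qed (simp add: periodic_closed[OF x])
next
  fix x y assume xy: "x \<in> periodic r" "y \<in> periodic r"
  show "x \<otimes>\<^bsub>P\<^esub> y \<in> periodic r"
  proof (rule periodicI)
    fix i j assume ij: "i < t" "j < t" "i mod r = j mod r"
    show "(x \<otimes>\<^bsub>P\<^esub> y) i = (x \<otimes>\<^bsub>P\<^esub> y) j"
      using ij(1,2) periodicD[OF xy(1) ij] periodicD[OF xy(2) ij] by simp
  qed (simp add: xy[THEN periodic_closed])
qed (use periodic_closed in blast)

lemma diag_in_periodic: "diag ` carrier L \<subseteq> periodic r"
  by (auto simp: periodic_def)

lemma shift_periodic_iff:
  assumes "r dvd t" "x \<in> carrier P"
  shows "\<sigma> x \<in> periodic r \<longleftrightarrow> x \<in> periodic r"
proof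
  assume x: "x \<in> periodic r"
  have "\<sigma> x i = \<sigma> x j" if "i < t" "j < t" "i mod r = j mod r" for i j
  proof -
    have "(i + (t - 1)) mod t mod r = (j + (t - 1)) mod t mod r"
      using mod_add_cong[OF that(3) refl, of "t - 1"] by (simp add: mod_mod_cancel[OF assms(1)])
    moreover have "(i + (t - 1)) mod t < t" "(j + (t - 1)) mod t < t" using that by auto
    ultimately have "x ((i + (t - 1)) mod t) = x ((j + (t - 1)) mod t)"
      using periodicD[OF x] by blast
    then show ?thesis
      using that assms(2) by (simp add: shift_app)
  qed
  then show "\<sigma> x \<in> periodic r" by (rule periodicI[OF shift_closed[OF assms(2)]])
next
  assume x: "\<sigma> x \<in> periodic r"
  have "x i = x j" if "i < t" "j < t" "i mod r = j mod r" for i j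
  proof -
    have "Suc i mod t mod r = Suc j mod t mod r"
      using mod_add_cong[OF that(3) refl, of 1] by (simp add: mod_mod_cancel[OF assms(1)])
    moreover have "Suc i mod t < t" "Suc j mod t < t" using that by auto
    ultimately have "\<sigma> x (Suc i mod t) = \<sigma> x (Suc j mod t)"
      using periodicD[OF x] by blast
    then show ?thesis
      using that assms(2) by (simp add: shift_app_Suc)
  qed
  then show "x \<in> periodic r" by (rule periodicI[OF assms(2)])
qed

lemma periodic_proper:
  assumes "1 < r" "r < t" and a: "a \<in> carrier L" "a \<noteq> \<one>"
  shows "periodic r \<noteq> diag ` carrier L" "periodic r \<noteq> carrier P"
proof -
  let ?x = "\<lambda>i\<in>{..<t}. if i mod r = 0 then a else \<one>"
  have "?x \<in> periodic r" using a by (auto simp: periodic_def carrier_P)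
  moreover have "?x 0 \<noteq> ?x 1" using assms by simp
  then have "?x \<notin> diag ` carrier L" using assms by (auto simp del: restrict_apply)
  ultimately show "periodic r \<noteq> diag ` carrier L" by blast
  have "single 0 a \<notin> periodic r"
  proof
    assume "single 0 a \<in> periodic r"
    then have "single 0 a 0 = single 0 a r" by (rule periodicD) (use assms in auto)
    then show False using assms by simp
  qed
  then show "periodic r \<noteq> carrier P" using single_closed[OF a(1)] by metis
qed

end

section \<open>Primitivity of the power quandle\<close>

theorem theorem4p10:
  fixes L :: "('a, 'b) monoid_scheme" and t :: nat
  assumes "simple_group L" and "finite (carrier L)" and "\<not> comm_group L"
    and "t \<ge> 1"
  shows "primitive_quandle (power_quandle L t (\<lambda>x\<in>carrier L. x)) \<longleftrightarrow> prime t"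
proof -
  interpret simple_group L by fact
  interpret group_power L t ..
  have Fix_eq: "Fix P \<sigma> = diag ` carrier L"
    using Fix_shift_auto[OF assms(4)] diag_fix_eq by metis
  interpret Q: coset_quandle_data P "diag ` carrier L" \<sigma>
    using subgroup_Fix[OF P.is_group shift_in_auto] shift_in_auto
    by (intro coset_quandle_data.intro coset_quandle_data_axioms.intro P.is_group)
      (simp_all add: Fix_eq)
  have Q_eq: "power_quandle L t (\<lambda>x\<in>carrier L. x) = coset_quandle P (diag ` carrier L) \<sigma>"
    by (simp add: power_quandle_def diag_fix_eq)
  obtain a where a: "a \<in> carrier L" "a \<noteq> \<one>\<^bsub>L\<^esub>"
    using simple_not_triv by blast
  show ?thesis
    unfolding Q_eq
  proof
    assume prime: "prime t"
    then have t: "t \<ge> 2" by (rule prime_ge_2_nat)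
    show "primitive_quandle (coset_quandle P (diag ` carrier L) \<sigma>)"
    proof (rule Q.primitive_coset_quandleI)
      show "generate P ((\<lambda>x. x \<otimes>\<^bsub>P\<^esub> inv\<^bsub>P\<^esub> (\<sigma> x)) ` carrier P) = carrier P"
        by (rule generate_shift_quotients[OF derived_eq_carrier[OF assms(3)] t])
      have "single 0 a \<notin> diag ` carrier L"
      proof
        assume "single 0 a \<in> diag ` carrier L"
        then obtain b where "single 0 a = diag b" by blast
        then have "single 0 a 0 = single 0 a 1" using t by simp
        then show False using t a(2) by simp
      qed
      then show "diag ` carrier L \<noteq> carrier P" using single_closed[OF a(1)] by metis
    next
      fix K assume K: "subgroup K P" "diag ` carrier L \<subseteq> K"
        and stable: "\<And>x. x \<in> carrier P \<Longrightarrow> \<sigma> x \<in> K \<longleftrightarrow> x \<in> K"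
      show "K = diag ` carrier L \<or> K = carrier P"
      proof (cases "\<exists>i j. i < j \<and> j < t \<and> (\<forall>x\<in>K. x i = x j)")
        case True
        then show ?thesis
          using prime_shift_stable_subgroup[OF prime K stable] by blast
      next
        case False
        then have "\<exists>x\<in>K. x i \<noteq> x j" if "i < t" "j < t" "i \<noteq> j" for i j
          using that by (metis linorder_neqE_nat)
        then have "K = carrier P"
          by (rule separating_subgroup_eq_carrier[OF assms(1,3) K])
        then show ?thesis ..
      qed
    qed
  next
    assume prim: "primitive_quandle (coset_quandle P (diag ` carrier L) \<sigma>)"
    note diag_proper = Q.primitive_coset_quandleD(1)[OF prim]
    note diag_maximal = Q.primitive_coset_quandleD(2)[OF prim]
    have "t \<noteq> 1"
    proof
      assume t: "t = 1"
      have "x \<in> diag ` carrier L" if x: "x \<in> carrier P" for x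
      proof (rule image_eqI)
        show x0: "x 0 \<in> carrier L" using x t by simp
        show "x = diag (x 0)"
        proof (rule P_eqI[OF x diag_closed[OF x0]])
          fix i assume "i < t"
          then show "x i = diag (x 0) i" using diag_app[of i "x 0"] t by simp
        qed
      qed
      then show False using diag_proper Q.H.subset by blast
    qed
    show "prime t"
    proof (rule ccontr)
      assume "\<not> prime t"
      then obtain r where r: "r dvd t" "r \<noteq> 1" "r \<noteq> t"
        using \<open>t \<noteq> 1\<close> assms(4) by (auto simp: prime_nat_iff)
      then have "1 < r" "r < t" using assms(4) by (auto intro!: le_neq_trans dvd_imp_le Suc_lessI gr0I)
      then show False
        using diag_maximal[OF periodic_subgroup diag_in_periodic shift_periodic_iff[OF r(1)]]
          periodic_proper a by blast
    qed
  qed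
qed

end
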